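(* Let $(u_l,u_r,\sigma)$ be a 2-contact discontinuity of the full Euler system for a perfect gas described below. If $e_l>e_r$, then for every $a\in(0,e_r/e_l)\cup(1,\infty)$, $(u_l,u_r,\sigma)$ does not satisfy $a$-contraction. If $e_l<e_r$, then for every $a\in(0,1)\cup(e_r/e_l,\infty)$, $(u_l,u_r,\sigma)$ does not satisfy $a$-contraction.
   Context: Full Euler system: $\partial_t\rho+\partial_x(\rho v)=0$, $\partial_t(\rho v)+\partial_x(\rho v^2+p)=0$, $\partial_t(\rho(\tfrac12v^2+e))+\partial_x(\rho(\tfrac12v^2+e)v+pv)=0$, with $p=(\gamma-1)\rho e$, $\gamma>1$, $\rho>0$, $e>0$. Conservative variables $u=(\rho,q,\mathcal E)$ with $q=\rho v$, $\mathcal E=\rho(\tfrac12v^2+e)$ (so $e=\mathcal E/\rho-q^2/(2\rho^2)$); entropy $\eta(u)=(\gamma-1)\rho\ln\rho-\rho\ln e$, with entropy flux $Q$ satisfying $\nabla Q=\nabla\eta\,\nabla F$ ($F$ the flux). Characteristic speeds $\lambda_1=v-c$, $\lambda_2=v$, $\lambda_3=v+c$, $c=\sqrt{\gamma(\gamma-1)e}$; the second field is linearly degenerate. A 2-contact discontinuity is a Rankine–Hugoniot discontinuity $(u_l,u_r,\sigma)$, $u_l\ne u_r$, of the second family, characterized by $v_l=v_r=\sigma$ and $p_l=p_r$; $e_l,e_r$ denote the internal energies of $u_l,u_r$. Relative entropy $\eta(u|w)=\eta(u)-\eta(w)-\nabla\eta(w)\cdot(u-w)$. a-contraction: with $E_a(u(t),h)=\int_{-\infty}^h\eta(u(t,x)|u_l)dx+a\int_h^\infty\eta(u(t,x)|u_r)dx$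 and $S(x)=u_l$ ($x<0$), $u_r$ ($x>0$), the discontinuity satisfies $a$-contraction if for every bounded convex set $\mathcal U_K$ of states there is $C_K$ such that for every entropy weak solution $u\in\mathcal U_K\cap BV_{loc}((0,T)\times\mathbb R)^3$ (weak solution with $\partial_t\eta(u)+\partial_xQ(u)\le0$) with initial datum $u_0$, $E_a(u_0,0)<\infty$, there is a Lipschitz $h$, $h(0)=0$, with $E_a(u(t),h(t))\le E_a(u(s),h(s))$ for a.e. $t>s>0$, $|h'(t)|\le C_K$, $|h(t)-\sigma t|\le C_K\sqrt t\|u_0-S\|_{L^2}$. *)

theory Defs
  imports "HOL-Analysis.Analysis"
begin

type_synonym state = "real \<times> real \<times> real"  (* conservative variables (rho, q, E) *)

definition rho :: "state \<Rightarrow> real" where "rho u = fst u"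
definition mom :: "state \<Rightarrow> real" where "mom u = fst (snd u)"
definition energy :: "state \<Rightarrow> real" where "energy u = snd (snd u)"
definition vel :: "state \<Rightarrow> real" where "vel u = mom u / rho u"
definition inte :: "state \<Rightarrow> real"
  where "inte u = energy u / rho u - (mom u)\<^sup>2 / (2 * (rho u)\<^sup>2)"
definition pres :: "real \<Rightarrow> state \<Rightarrow> real"
  where "pres \<gamma> u = (\<gamma> - 1) * rho u * inte u"

definition flux :: "real \<Rightarrow> state \<Rightarrow> state" where
  "flux \<gamma> u = (mom u, (mom u)\<^sup>2 / rho u + pres \<gamma> u, (energy u + pres \<gamma> u) * vel u)"

definition phys_states :: "state set" where
  "phys_states = {u. rho u > 0 \<and> inte u > 0}"

definition entropy :: "real \<Rightarrow> state \<Rightarrow> real" where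
  "entropy \<gamma> u = (\<gamma> - 1) * rho u * ln (rho u) - rho u * ln (inte u)"

(* entropy flux Q = eta * v; it satisfies grad Q = grad eta grad F on phys_states
   (Q is determined up to an additive constant, which is irrelevant) *)
definition entropy_flux :: "real \<Rightarrow> state \<Rightarrow> real" where
  "entropy_flux \<gamma> u = entropy \<gamma> u * vel u"

definition rel_entropy :: "real \<Rightarrow> state \<Rightarrow> state \<Rightarrow> real" where
  "rel_entropy \<gamma> u w =
     entropy \<gamma> u - entropy \<gamma> w - frechet_derivative (entropy \<gamma>) (at w) (u - w)"

definition contact2 :: "real \<Rightarrow> state \<Rightarrow> state \<Rightarrow> real \<Rightarrow> bool" where
  "contact2 \<gamma> ul ur \<sigma> \<longleftrightarrow> ul \<in> phys_states \<and> ur \<in> phys_states \<and> ul \<noteq> ur \<and>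
     vel ul = \<sigma> \<and> vel ur = \<sigma> \<and> pres \<gamma> ul = pres \<gamma> ur"

definition shock_profile :: "state \<Rightarrow> state \<Rightarrow> real \<Rightarrow> state" where
  "shock_profile ul ur x = (if x < 0 then ul else ur)"

definition E_a :: "real \<Rightarrow> real \<Rightarrow> state \<Rightarrow> state \<Rightarrow> (real \<Rightarrow> state) \<Rightarrow> real \<Rightarrow> ennreal" where
  "E_a \<gamma> a ul ur f h =
     (\<integral>\<^sup>+ x \<in> {..<h}. ennreal (rel_entropy \<gamma> (f x) ul) \<partial>lborel)
     + ennreal a * (\<integral>\<^sup>+ x \<in> {h<..}. ennreal (rel_entropy \<gamma> (f x) ur) \<partial>lborel)"

definition test_fn :: "(real \<Rightarrow> real \<Rightarrow> real) \<Rightarrow> (real \<Rightarrow> real \<Rightarrow> real) \<Rightarrow> (real \<Rightarrow> real \<Rightarrow> real) \<Rightarrow> bool" where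
  "test_fn \<phi> \<phi>t \<phi>x \<longleftrightarrow>
     (\<forall>t x. ((\<lambda>p. \<phi> (fst p) (snd p)) has_derivative
              (\<lambda>d. fst d * \<phi>t t x + snd d * \<phi>x t x)) (at (t, x))) \<and>
     continuous_on UNIV (\<lambda>p. \<phi>t (fst p) (snd p)) \<and>
     continuous_on UNIV (\<lambda>p. \<phi>x (fst p) (snd p))"

(* u in BV_loc((0,T) x R): distributional gradient is locally a finite measure *)
definition BV_loc :: "real \<Rightarrow> (real \<Rightarrow> real \<Rightarrow> state) \<Rightarrow> bool" where
  "BV_loc T u \<longleftrightarrow>
     (\<forall>K. compact K \<and> K \<subseteq> {0<..<T} \<times> UNIV \<longrightarrow>
       (\<exists>M. \<forall>\<psi>1 \<psi>1t \<psi>1x \<psi>2 \<psi>2t \<psi>2x.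
          test_fn \<psi>1 \<psi>1t \<psi>1x \<and> test_fn \<psi>2 \<psi>2t \<psi>2x \<and>
          (\<forall>t x. (t, x) \<notin> K \<longrightarrow> \<psi>1 t x = 0 \<and> \<psi>2 t x = 0) \<and>
          (\<forall>t x. (\<psi>1 t x)\<^sup>2 + (\<psi>2 t x)\<^sup>2 \<le> 1) \<longrightarrow>
          norm (LINT p : {0<..<T} \<times> UNIV | lborel.
                  (\<psi>1t (fst p) (snd p) + \<psi>2x (fst p) (snd p)) *\<^sub>R u (fst p) (snd p)) \<le> M))"

definition entropy_weak_solution ::
  "real \<Rightarrow> real \<Rightarrow> state set \<Rightarrow> (real \<Rightarrow> real \<Rightarrow> state) \<Rightarrow> (real \<Rightarrow> state) \<Rightarrow> bool" where
  "entropy_weak_solution \<gamma> T U u u0 \<longleftrightarrow>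
     (\<lambda>p. u (fst p) (snd p)) \<in> borel_measurable lborel \<and>
     (\<forall>t \<in> {0<..<T}. \<forall>x. u t x \<in> U) \<and>
     u0 \<in> borel_measurable lborel \<and> (\<forall>x. u0 x \<in> U) \<and>
     BV_loc T u \<and>
     (\<forall>\<phi> \<phi>t \<phi>x. test_fn \<phi> \<phi>t \<phi>x \<and>
        (\<exists>T' R. T' < T \<and> (\<forall>t x. \<phi> t x \<noteq> 0 \<longrightarrow> t \<le> T' \<and> \<bar>x\<bar> \<le> R)) \<longrightarrow>
        (LINT p : {0<..<T} \<times> UNIV | lborel.
            \<phi>t (fst p) (snd p) *\<^sub>R u (fst p) (snd p)
            + \<phi>x (fst p) (snd p) *\<^sub>R flux \<gamma> (u (fst p) (snd p)))
        + (LINT x | lborel. \<phi> 0 x *\<^sub>R u0 x) = 0) \<and>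
     (\<forall>\<phi> \<phi>t \<phi>x. test_fn \<phi> \<phi>t \<phi>x \<and> (\<forall>t x. 0 \<le> \<phi> t x) \<and>
        (\<exists>T1 T2 R. 0 < T1 \<and> T2 < T \<and>
           (\<forall>t x. \<phi> t x \<noteq> 0 \<longrightarrow> T1 \<le> t \<and> t \<le> T2 \<and> \<bar>x\<bar> \<le> R)) \<longrightarrow>
        0 \<le> (LINT p : {0<..<T} \<times> UNIV | lborel.
            \<phi>t (fst p) (snd p) * entropy \<gamma> (u (fst p) (snd p))
            + \<phi>x (fst p) (snd p) * entropy_flux \<gamma> (u (fst p) (snd p))))"

definition a_contraction :: "real \<Rightarrow> real \<Rightarrow> state \<Rightarrow> state \<Rightarrow> real \<Rightarrow> bool" where
  "a_contraction \<gamma> a ul ur \<sigma> \<longleftrightarrow>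
     (\<forall>U. U \<subseteq> phys_states \<and> bounded U \<and> convex U \<longrightarrow>
       (\<exists>C>0. \<forall>T>0. \<forall>u u0.
          entropy_weak_solution \<gamma> T U u u0 \<and> E_a \<gamma> a ul ur u0 0 < \<infinity> \<longrightarrow>
          (\<exists>h. h 0 = 0 \<and> (\<exists>L. L-lipschitz_on {0..<T} h) \<and>
             (AE t in lborel. 0 < t \<and> t < T \<longrightarrow>
                (\<forall>D. (h has_real_derivative D) (at t) \<longrightarrow> \<bar>D\<bar> \<le> C)) \<and>
             (\<forall>t \<in> {0..<T}. ennreal ((h t - \<sigma> * t)\<^sup>2)
                 \<le> ennreal (C\<^sup>2 * t) *
                   (\<integral>\<^sup>+ x. ennreal ((norm (u0 x - shock_profile ul ur x))\<^sup>2) \<partial>lborel)) \<and>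
             (AE p in lborel. 0 < fst p \<and> fst p < snd p \<and> snd p < T \<longrightarrow>
                E_a \<gamma> a ul ur (u (snd p)) (h (snd p))
                  \<le> E_a \<gamma> a ul ur (u (fst p)) (h (fst p))))))"

end

theory Submission
  imports Defs
begin

text \<open>For a state u with density \<open>\<rho>\<close>, velocity v and pressure p, and for w equal to \<open>ul\<close> or \<open>ur\<close>,
  the relative entropy flux is \<open>v \<cdot> \<eta>(u|w) + (v - \<sigma>)(p - P) / e(w)\<close>, where P is the common pressure.
  Hence, if the solution is constantly u near the shift and
  \<open>\<eta>(u|ul) = a \<cdot> \<eta>(u|ur)\<close>, the weighted relative entropy does not depend on the position of the shift
  and grows at the rate \<open>-(v - \<sigma>)(p - P)(1/e(ul) - a/e(ur))\<close>, provided no entropy is dissipated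
  elsewhere. States on an acoustic rarefaction curve through \<open>ul\<close> or \<open>ur\<close> give
  \<open>(v - \<sigma>)(p - P)\<close> either sign, depending on the family, and for a outside the stated range
  the balance \<open>\<eta>(u|ul) = a \<cdot> \<eta>(u|ur)\<close> is reached along that curve by the intermediate value theorem.

  A dissipation-free solution with such a plateau is a short-time C1 flow: a simple-wave pulse on a
  background in which the contact is smeared out into a smooth density transition at constant
  velocity and pressure. All data are carried along straight characteristics
  \<open>x = y + t \<cdot> \<Lambda> y\<close>, with \<open>\<Lambda> = \<sigma>\<close> in the density transition.\<close>

section \<open>Green's formula on rectangles\<close>

text \<open>In the definition of a-contraction the constant \<open>C\<close> is fixed once the set
  of states \<open>U\<close> is, and the shift deviates from \<open>\<sigma> * t\<close> by at most
  a multiple of sqrt t. So one profile is fixed, \<open>U\<close> is the convex hull of its values,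
  and only then is the time horizon chosen, depending on \<open>C\<close>, so short that every
  admissible shift stays inside the plateau. Where it sits inside is not controlled: the growth must
  hold for all positions at once, and this forces the exact balance of the two relative entropies.
  The definition admits any data with finite weighted relative entropy, so the contact may be
  smeared; with C1 data the weak form, the BV bound and the entropy identity all reduce to Green's
  formula. Pulse and density transition travel at different speeds and are separated by stretches of
  constant state, on which the speed can be interpolated freely because nothing is transported
  there. The growth rate changes sign at a = e_r/e_l. Below this value the curve starts at
  \<open>ul\<close>, above it at \<open>ur\<close>; either choice gives the initial sign needed for
  a zero.\<close>

lemma green_rectangle:
  fixes P Pt N Nx :: "real \<Rightarrow> real \<Rightarrow> 'a::euclidean_space"
  assumes "a \<le> b" "c \<le> d"
    and P: "\<And>t x. t \<in> {a..b} \<Longrightarrow> x \<in> {c..d} \<Longrightarrow> ((\<lambda>r. P r x) has_vector_derivative Pt t x) (at t)"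
    and N: "\<And>t x. t \<in> {a..b} \<Longrightarrow> x \<in> {c..d} \<Longrightarrow> ((\<lambda>z. N t z) has_vector_derivative Nx t x) (at x)"
    and cP: "continuous_on ({a..b} \<times> {c..d}) (\<lambda>p. Pt (fst p) (snd p))"
    and cN: "continuous_on ({a..b} \<times> {c..d}) (\<lambda>p. Nx (fst p) (snd p))"
  shows "integral (cbox (a, c) (b, d)) (\<lambda>p. Pt (fst p) (snd p) + Nx (fst p) (snd p)) =
    integral {c..d} (\<lambda>x. P b x - P a x) + integral {a..b} (\<lambda>t. N t d - N t c)"
proof -
  have box: "cbox (a, c) (b, d) = {a..b} \<times> {c..d}"
    by (auto simp: cbox_Pair_eq)
  have cP': "continuous_on (cbox (a, c) (b, d)) (\<lambda>p. Pt (fst p) (snd p))"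
    and cN': "continuous_on (cbox (a, c) (b, d)) (\<lambda>p. Nx (fst p) (snd p))"
    using cP cN by (simp_all add: box)
  have "integral (cbox (a, c) (b, d)) (\<lambda>p. Pt (fst p) (snd p)) =
        integral (cbox a b) (\<lambda>t. integral (cbox c d) (\<lambda>x. Pt t x))"
    using integral_prod_continuous[OF cP'] by simp
  also have "\<dots> = integral (cbox c d) (\<lambda>x. integral (cbox a b) (\<lambda>t. Pt t x))"
    by (rule integral_swap_continuous) (use cP' in \<open>simp add: case_prod_beta'\<close>)
  also have "\<dots> = integral {c..d} (\<lambda>x. P b x - P a x)"
    unfolding cbox_interval
  proof (rule integral_cong)
    fix x assume x: "x \<in> {c..d}"
    have "((\<lambda>t. Pt t x) has_integral (P b x - P a x)) {a..b}"
      using assms(1) by (rule fundamental_theorem_of_calculus)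
        (use P x in \<open>auto intro: has_vector_derivative_at_within\<close>)
    then show "integral {a..b} (\<lambda>t. Pt t x) = P b x - P a x"
      by (rule integral_unique)
  qed
  finally have 1: "integral (cbox (a, c) (b, d)) (\<lambda>p. Pt (fst p) (snd p)) =
    integral {c..d} (\<lambda>x. P b x - P a x)" .
  have "integral (cbox (a, c) (b, d)) (\<lambda>p. Nx (fst p) (snd p)) =
        integral (cbox a b) (\<lambda>t. integral (cbox c d) (\<lambda>x. Nx t x))"
    using integral_prod_continuous[OF cN'] by simp
  also have "\<dots> = integral {a..b} (\<lambda>t. N t d - N t c)"
    unfolding cbox_interval
  proof (rule integral_cong)
    fix t assume t: "t \<in> {a..b}"
    have "((\<lambda>x. Nx t x) has_integral (N t d - N t c)) {c..d}"
      using assms(2) by (rule fundamental_theorem_of_calculus)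
        (use N t in \<open>auto intro: has_vector_derivative_at_within\<close>)
    then show "integral {c..d} (\<lambda>x. Nx t x) = N t d - N t c"
      by (rule integral_unique)
  qed
  finally have 2: "integral (cbox (a, c) (b, d)) (\<lambda>p. Nx (fst p) (snd p)) =
    integral {a..b} (\<lambda>t. N t d - N t c)" .
  show ?thesis
    using integrable_continuous[OF cP'] integrable_continuous[OF cN']
    by (simp add: integral_add 1 2)
qed

text \<open>Passes from the Lebesgue integral over the open strip, as in the definition of a weak
  solution, to the gauge integral in \<open>green_rectangle\<close>: inside the strip the integrand
  vanishes off the box, and the boundary of the box is a null set.\<close>

lemma strip_integral_eq_integral_cbox:
  fixes K :: "real \<times> real \<Rightarrow> 'a::euclidean_space"
  assumes cont: "continuous_on ({0..T} \<times> {-R..R}) K"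
    and zero: "\<And>t x. 0 < t \<Longrightarrow> t < T \<Longrightarrow> R \<le> \<bar>x\<bar> \<Longrightarrow> K (t, x) = 0"
  shows "(LINT p : {0<..<T} \<times> UNIV | lborel. K p) = integral (cbox (0, -R) (T, R)) K"
proof -
  have box: "box (0, -R) (T, R) = {0<..<T} \<times> {-R<..<R}"
    by (auto simp: box_def Basis_prod_def)
  have cbox: "cbox (0, -R) (T, R) = {0..T} \<times> {-R..R}"
    by (auto simp: cbox_Pair_eq)
  have eq: "indicator ({0<..<T} \<times> UNIV) p *\<^sub>R K p = indicator (box (0, -R) (T, R)) p *\<^sub>R K p" for p
  proof (cases p)
    case (Pair t x)
    then show ?thesis
      unfolding box by (cases "\<bar>x\<bar> < R") (use zero[of t x] in \<open>auto simp: indicator_def\<close>)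
  qed
  have "set_integrable lborel (cbox (0, -R) (T, R)) K"
    unfolding set_integrable_def
    by (rule borel_integrable_compact) (use cont in \<open>simp_all add: cbox compact_Times\<close>)
  then have "set_integrable lborel (box (0, -R) (T, R)) K"
    by (rule set_integrable_subset) (auto simp: box_subset_cbox)
  then have "(LINT p : box (0, -R) (T, R) | lborel. K p) = integral (cbox (0, -R) (T, R)) K"
    by (simp add: set_borel_integral_eq_integral integral_open_interval)
  then show ?thesis
    unfolding set_lebesgue_integral_def eq .
qed

section \<open>Test functions\<close>

lemma test_fn_partials:
  assumes "test_fn \<phi> \<phi>t \<phi>x"
  shows "((\<lambda>r. \<phi> r x) has_real_derivative \<phi>t t x) (at t)"
    and "((\<lambda>z. \<phi> t z) has_real_derivative \<phi>x t x) (at x)"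
proof -
  have D: "((\<lambda>p. \<phi> (fst p) (snd p)) has_derivative
              (\<lambda>d. fst d * \<phi>t t x + snd d * \<phi>x t x)) (at (t, x))"
    using assms by (auto simp: test_fn_def)
  have "((\<lambda>r. (r, x)) has_derivative (\<lambda>h. (h, 0))) (at t)"
    by (auto intro!: derivative_eq_intros)
  from has_derivative_compose[OF this, of "\<lambda>p. \<phi> (fst p) (snd p)", OF D]
  show "((\<lambda>r. \<phi> r x) has_real_derivative \<phi>t t x) (at t)"
    by (simp add: has_field_derivative_def mult_commute_abs)
  have "((\<lambda>z. (t, z)) has_derivative (\<lambda>h. (0, h))) (at x)"
    by (auto intro!: derivative_eq_intros)
  from has_derivative_compose[OF this, of "\<lambda>p. \<phi> (fst p) (snd p)", OF D]
  show "((\<lambda>z. \<phi> t z) has_real_derivative \<phi>x t x) (at x)"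
    by (simp add: has_field_derivative_def mult_commute_abs)
qed

lemma test_fn_continuous:
  assumes "test_fn \<phi> \<phi>t \<phi>x"
  shows "continuous_on S (\<lambda>p. \<phi> (fst p) (snd p))"
    and "continuous_on S (\<lambda>p. \<phi>t (fst p) (snd p))"
    and "continuous_on S (\<lambda>p. \<phi>x (fst p) (snd p))"
proof -
  have "isCont (\<lambda>p. \<phi> (fst p) (snd p)) (t, x)" for t x
    using assms unfolding test_fn_def by (auto intro: has_derivative_continuous)
  then show "continuous_on S (\<lambda>p. \<phi> (fst p) (snd p))"
    by (intro continuous_at_imp_continuous_on) auto
  show "continuous_on S (\<lambda>p. \<phi>t (fst p) (snd p))" "continuous_on S (\<lambda>p. \<phi>x (fst p) (snd p))"
    using assms by (auto simp: test_fn_def intro: continuous_on_subset)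
qed

text \<open>In \<open>test_fn\<close> the partials are separate data, tied to \<open>\<phi>\<close>
  only through the derivative; uniqueness of that derivative on an open set transfers the
  vanishing.\<close>

lemma test_fn_partials_eq_0:
  assumes "test_fn \<phi> \<phi>t \<phi>x" "open S" "(t, x) \<in> S"
    and zero: "\<And>r z. (r, z) \<in> S \<Longrightarrow> \<phi> r z = 0"
  shows "\<phi>t t x = 0" "\<phi>x t x = 0"
proof -
  have D: "((\<lambda>p. \<phi> (fst p) (snd p)) has_derivative
              (\<lambda>d. fst d * \<phi>t t x + snd d * \<phi>x t x)) (at (t, x))"
    using assms by (auto simp: test_fn_def)
  have "((\<lambda>p. 0) has_derivative (\<lambda>d. fst d * \<phi>t t x + snd d * \<phi>x t x)) (at (t, x))"
    by (rule has_derivative_transform_within_open[OF D assms(2,3)]) (use zero in auto)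
  then have eq: "(\<lambda>d. fst d * \<phi>t t x + snd d * \<phi>x t x) = (\<lambda>d. 0)"
    by (intro has_derivative_unique[of "\<lambda>p. 0::real"]) auto
  show "\<phi>t t x = 0" using fun_cong[OF eq, of "(1,0)"] by simp
  show "\<phi>x t x = 0" using fun_cong[OF eq, of "(0,1)"] by simp
qed

lemma test_fn_partials_eq_0_outside:
  assumes "test_fn \<phi> \<phi>t \<phi>x" "R < \<bar>x\<bar>"
    and "\<And>r z. R < \<bar>z\<bar> \<Longrightarrow> \<phi> r z = 0"
  shows "\<phi>t t x = 0" "\<phi>x t x = 0"
proof -
  have "open (UNIV \<times> {z::real. R < \<bar>z\<bar>} :: (real \<times> real) set)"
    by (intro open_Times open_UNIV open_Collect_less continuous_intros)
  from test_fn_partials_eq_0[OF assms(1) this, of t x] assms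
  show "\<phi>t t x = 0" "\<phi>x t x = 0" by auto
qed

section \<open>Solutions transported along straight characteristics\<close>

locale characteristics =
  fixes \<Lambda> \<Lambda>' :: "real \<Rightarrow> real" and L B \<tau> :: real
  assumes deriv_speed: "\<And>y. (\<Lambda> has_real_derivative \<Lambda>' y) (at y)"
    and cont_deriv_speed: "continuous_on UNIV \<Lambda>'"
    and deriv_speed_bound: "\<And>y. \<bar>\<Lambda>' y\<bar> \<le> L"
    and speed_bound: "\<And>y. \<bar>\<Lambda> y\<bar> \<le> B"
    and tau_pos: "0 < \<tau>"
    and tau_L: "\<tau> * L \<le> 1/2"
begin

definition clip :: "real \<Rightarrow> real" where "clip t = max (-\<tau>) (min \<tau> t)"

text \<open>Characteristics do not cross for \<open>\<bar>t\<bar> \<le> \<tau>\<close>; clipping the time makes \<open>foot\<close> continuous on the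
  whole plane.\<close>

definition foot :: "real \<Rightarrow> real \<Rightarrow> real" where
  "foot t x = (THE y. y + clip t * \<Lambda> y = x)"

lemma clip_eq: "\<bar>t\<bar> \<le> \<tau> \<Longrightarrow> clip t = t"
  by (auto simp: clip_def)

lemma abs_clip_le: "\<bar>clip t\<bar> \<le> \<tau>"
  using tau_pos by (auto simp: clip_def)

lemma clip_lipschitz: "\<bar>clip t - clip s\<bar> \<le> \<bar>t - s\<bar>"
  by (auto simp: clip_def max_def min_def)

lemma speed_lipschitz: "\<bar>\<Lambda> y - \<Lambda> z\<bar> \<le> L * \<bar>y - z\<bar>"
  using field_differentiable_bound[of UNIV \<Lambda> \<Lambda>' L y z] deriv_speed deriv_speed_bound
  by (auto intro: has_field_derivative_at_within)

lemma L_nonneg: "0 \<le> L"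
  using deriv_speed_bound[of 0] by linarith

lemma B_nonneg: "0 \<le> B"
  using speed_bound[of 0] by linarith

lemma isCont_speed: "isCont \<Lambda> y"
  using deriv_speed by (rule DERIV_isCont)

text \<open>\<open>\<tau> * L \<le> 1/2\<close> makes the displacement a contraction in the starting
  point. The factor 1/2 gives uniqueness of the foot here, and the Lipschitz bound and the positive
  Jacobian later.\<close>

lemma clip_speed_diff: "2 * \<bar>clip t * (\<Lambda> y - \<Lambda> z)\<bar> \<le> \<bar>y - z\<bar>"
proof -
  have "\<bar>clip t * (\<Lambda> y - \<Lambda> z)\<bar> \<le> \<tau> * (L * \<bar>y - z\<bar>)"
    unfolding abs_mult using abs_clip_le speed_lipschitz tau_pos by (intro mult_mono) auto
  also have "\<dots> \<le> 1/2 * \<bar>y - z\<bar>"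
    using mult_right_mono[OF tau_L, of "\<bar>y - z\<bar>"] by (simp add: mult.assoc)
  finally show ?thesis by simp
qed

lemma foot_ex1: "\<exists>!y. y + clip t * \<Lambda> y = x"
proof -
  have b: "\<bar>clip t * \<Lambda> y\<bar> \<le> \<tau> * B" for y
    unfolding abs_mult using abs_clip_le speed_bound tau_pos by (intro mult_mono) auto
  \<comment> \<open>No characteristic moves by more than \<open>\<tau> * B\<close>, so this interval
    brackets the foot.\<close>
  have "\<exists>y. x - \<tau> * B \<le> y \<and> y \<le> x + \<tau> * B \<and> y + clip t * \<Lambda> y = x"
  proof (rule IVT)
    show "x - \<tau> * B + clip t * \<Lambda> (x - \<tau> * B) \<le> x"
      using b[of "x - \<tau> * B"] by linarith
    show "x \<le> x + \<tau> * B + clip t * \<Lambda> (x + \<tau> * B)"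
      using b[of "x + \<tau> * B"] by linarith
    show "x - \<tau> * B \<le> x + \<tau> * B"
      using mult_nonneg_nonneg[OF less_imp_le[OF tau_pos] B_nonneg] by linarith
  qed (auto intro!: isCont_speed continuous_intros)
  then obtain y where y: "y + clip t * \<Lambda> y = x" by blast
  moreover have "z = y" if "z + clip t * \<Lambda> z = x" for z
  proof -
    define e where "e = clip t * (\<Lambda> y - \<Lambda> z)"
    have "y - z = - e"
      using y that by (simp add: e_def algebra_simps)
    moreover have "2 * \<bar>e\<bar> \<le> \<bar>y - z\<bar>"
      using clip_speed_diff[of t y z] unfolding e_def .
    ultimately have "2 * \<bar>e\<bar> \<le> \<bar>e\<bar>" by simp
    then show ?thesis using \<open>y - z = - e\<close> by simp
  qed
  ultimately show ?thesis by blast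
qed

lemma foot_eq: "foot t x + clip t * \<Lambda> (foot t x) = x"
  unfolding foot_def using foot_ex1 by (rule theI')

lemma foot_unique: "y + clip t * \<Lambda> y = x \<Longrightarrow> foot t x = y"
  using foot_ex1 foot_eq by blast

lemma foot_0 [simp]: "foot 0 x = x"
  by (rule foot_unique) (use tau_pos in \<open>simp add: clip_eq\<close>)

lemma foot_near: "\<bar>foot t x - x\<bar> \<le> \<tau> * B"
proof -
  have "\<bar>clip t * \<Lambda> (foot t x)\<bar> \<le> \<tau> * B"
    unfolding abs_mult using abs_clip_le speed_bound tau_pos by (intro mult_mono) auto
  then show ?thesis using foot_eq[of t x] by linarith
qed

lemma foot_lipschitz: "\<bar>foot t x - foot s z\<bar> \<le> 2 * \<bar>x - z\<bar> + 2 * B * \<bar>t - s\<bar>"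
proof -
  let ?y = "foot t x" and ?w = "foot s z"
  define d e where "d = clip t * (\<Lambda> ?y - \<Lambda> ?w)" and "e = (clip t - clip s) * \<Lambda> ?w"
  have "?y - ?w = (x - z) - d - e"
    using foot_eq[of t x] foot_eq[of s z] by (simp add: d_def e_def algebra_simps)
  moreover have "\<bar>e\<bar> \<le> \<bar>t - s\<bar> * B"
    unfolding e_def abs_mult using clip_lipschitz speed_bound by (intro mult_mono) auto
  moreover have "2 * \<bar>d\<bar> \<le> \<bar>?y - ?w\<bar>"
    unfolding d_def by (rule clip_speed_diff)
  moreover have "\<bar>x - z - d - e\<bar> \<le> \<bar>x - z\<bar> + \<bar>d\<bar> + \<bar>e\<bar>"
    by linarith
  \<comment> \<open>The part \<open>d\<close>, due to the different speeds at the two feet, is at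
    most half of the left distance and is absorbed; this produces the factor 2.\<close>
  ultimately have "2 * \<bar>?y - ?w\<bar> \<le> 2 * \<bar>x - z\<bar> + \<bar>?y - ?w\<bar> + 2 * (\<bar>t - s\<bar> * B)"
    by (smt (verit))
  then show ?thesis by (simp add: mult_ac)
qed

lemma continuous_foot: "continuous_on S (\<lambda>p. foot (fst p) (snd p))"
proof -
  have "(2 + 2 * B)-lipschitz_on S (\<lambda>p. foot (fst p) (snd p))"
  proof (rule lipschitz_onI)
    fix p q :: "real \<times> real"
    have 1: "\<bar>snd p - snd q\<bar> \<le> dist p q" "\<bar>fst p - fst q\<bar> \<le> dist p q"
      using dist_snd_le[of p q] dist_fst_le[of p q] by (simp_all add: dist_real_def)
    have "dist (foot (fst p) (snd p)) (foot (fst q) (snd q))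
       \<le> 2 * \<bar>snd p - snd q\<bar> + 2 * B * \<bar>fst p - fst q\<bar>"
      using foot_lipschitz by (simp add: dist_real_def)
    also have "\<dots> \<le> 2 * dist p q + 2 * B * dist p q"
      using 1 B_nonneg by (intro add_mono mult_left_mono) auto
    finally show "dist (foot (fst p) (snd p)) (foot (fst q) (snd q)) \<le> (2 + 2 * B) * dist p q"
      by (simp add: algebra_simps)
  qed (use B_nonneg in auto)
  then show ?thesis by (rule lipschitz_on_continuous_on)
qed

lemma continuous_compose_foot:
  fixes G :: "real \<Rightarrow> 'b::topological_space"
  assumes "continuous_on UNIV G"
  shows "continuous_on S (\<lambda>p. G (foot (fst p) (snd p)))"
  using continuous_on_compose2[OF assms continuous_foot] by auto

lemma continuous_compose_foot_x:
  fixes G :: "real \<Rightarrow> 'b::topological_space"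
  assumes "continuous_on UNIV G"
  shows "continuous_on S (\<lambda>x. G (foot t x))"
  using continuous_on_compose2[OF continuous_compose_foot[OF assms, of UNIV]
      continuous_on_Pair[OF continuous_on_const continuous_on_id]] by simp

lemma isCont_foot_t: "isCont (\<lambda>r. foot r x) t"
proof -
  have "continuous_on UNIV (\<lambda>r. foot (fst (r, x)) (snd (r, x)))"
    by (rule continuous_on_compose2[OF continuous_foot[of UNIV]]) (auto intro!: continuous_intros)
  then show ?thesis by (simp add: continuous_on_eq_continuous_at)
qed

lemma isCont_foot_x: "isCont (\<lambda>z. foot t z) x"
proof -
  have "continuous_on UNIV (\<lambda>z. foot (fst (t, z)) (snd (t, z)))"
    by (rule continuous_on_compose2[OF continuous_foot[of UNIV]]) (auto intro!: continuous_intros)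
  then show ?thesis by (simp add: continuous_on_eq_continuous_at)
qed

lemma tau_bound_half:
  assumes "\<bar>t\<bar> \<le> \<tau>" "\<bar>d\<bar> \<le> L" shows "\<bar>t * d\<bar> \<le> 1/2"
proof -
  have "\<bar>t * d\<bar> \<le> \<tau> * L"
    unfolding abs_mult using assms L_nonneg tau_pos by (intro mult_mono) auto
  then show ?thesis using tau_L by linarith
qed

abbreviation jac :: "real \<Rightarrow> real \<Rightarrow> real" where
  "jac t x \<equiv> 1 + t * \<Lambda>' (foot t x)"

lemma jac_pos: "\<bar>t\<bar> \<le> \<tau> \<Longrightarrow> 0 < jac t x"
  using tau_bound_half[of t "\<Lambda>' (foot t x)"] deriv_speed_bound[of "foot t x"] by linarith

lemma foot_deriv_x:
  assumes "\<bar>t\<bar> \<le> \<tau>"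
  shows "((\<lambda>z. foot t z) has_real_derivative inverse (jac t x)) (at x)"
proof (rule DERIV_inverse_function)
  show "((\<lambda>y. y + t * \<Lambda> y) has_real_derivative jac t x) (at (foot t x))"
    using deriv_speed by (auto intro!: derivative_eq_intros)
  show "jac t x \<noteq> 0" using jac_pos[OF assms, of x] by simp
  show "x - 1 < x" "x < x + 1" by auto
  show "foot t z + t * \<Lambda> (foot t z) = z" for z
    using foot_eq[of t z] assms by (simp add: clip_eq)
  show "isCont (foot t) x" using isCont_foot_x by simp
qed

text \<open>Implicit differentiation of the characteristic equation. With Caratheodory's slope
  function \<open>g\<close> of \<open>\<Lambda>\<close> at the foot, the difference quotient is
  solved for exactly, and \<open>\<bar>r * g z\<bar> \<le> 1/2\<close> keeps the denominator away
  from 0. The clipped time has corners at \<open>\<tau>\<close> and \<open>- \<tau>\<close>, hence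
  the strict bound.\<close>

lemma foot_deriv_t:
  assumes t: "\<bar>t\<bar> < \<tau>"
  shows "((\<lambda>r. foot r x) has_real_derivative - \<Lambda> (foot t x) * inverse (jac t x)) (at t)"
proof -
  let ?y = "foot t x"
  obtain g where g: "\<And>z. \<Lambda> z - \<Lambda> ?y = g z * (z - ?y)" "isCont g ?y" "g ?y = \<Lambda>' ?y"
    using deriv_speed[of ?y] unfolding CARAT_DERIV by blast
  have gL: "\<bar>g z\<bar> \<le> L" for z
  proof (cases "z = ?y")
    case True then show ?thesis using g(3) deriv_speed_bound by simp
  next
    case False
    have "\<bar>g z\<bar> * \<bar>z - ?y\<bar> \<le> L * \<bar>z - ?y\<bar>"
      using speed_lipschitz[of z ?y] g(1)[of z] by (simp add: abs_mult)
    then show ?thesis using False by (simp add: mult_le_cancel_right)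
  qed
  have cg: "isCont (\<lambda>r. g (foot r x)) t"
    using isCont_o2[OF isCont_foot_t g(2)] .
  have pos: "1 + t * g ?y \<noteq> 0"
    using tau_bound_half[of t "g ?y"] gL[of ?y] t by linarith
  have lim: "((\<lambda>r. - \<Lambda> ?y / (1 + r * g (foot r x))) \<longlongrightarrow> - \<Lambda> ?y / (1 + t * g ?y)) (at t)"
    using cg pos by (intro tendsto_intros) (auto simp: isCont_def)
  have "((\<lambda>r. (foot r x - foot t x) / (r - t)) \<longlongrightarrow> - \<Lambda> ?y / (1 + t * g ?y)) (at t)"
  proof (rule Lim_transform_within_open[OF lim, of "{-\<tau><..<\<tau>}"])
    fix r assume r: "r \<in> {-\<tau><..<\<tau>}" "r \<noteq> t"
    have nz: "1 + r * g (foot r x) \<noteq> 0"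
      using tau_bound_half[of r "g (foot r x)"] gL[of "foot r x"] r by (auto simp: abs_le_iff)
    have "foot r x + r * \<Lambda> (foot r x) = x" "?y + t * \<Lambda> ?y = x"
      using foot_eq[of r x] foot_eq[of t x] clip_eq[of r] clip_eq[of t] r t by auto
    moreover have "\<Lambda> (foot r x) = \<Lambda> ?y + g (foot r x) * (foot r x - ?y)"
      using g(1)[of "foot r x"] by simp
    ultimately have "foot r x + r * (\<Lambda> ?y + g (foot r x) * (foot r x - ?y)) = ?y + t * \<Lambda> ?y"
      by simp
    then have "(foot r x - ?y) * (1 + r * g (foot r x)) = - \<Lambda> ?y * (r - t)"
      by algebra
    then show "- \<Lambda> ?y / (1 + r * g (foot r x)) = (foot r x - foot t x) / (r - t)"
      using nz r by (subst frac_eq_eq) (simp_all add: mult.commute)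
  qed (use t in auto)
  then show ?thesis
    using g(3) by (simp add: has_field_derivative_iff divide_inverse)
qed

lemma compose_foot_deriv_t:
  fixes G G' :: "real \<Rightarrow> 'b::real_normed_vector"
  assumes "\<bar>t\<bar> < \<tau>" and G: "\<And>y. (G has_vector_derivative G' y) (at y)"
  shows "((\<lambda>r. G (foot r x)) has_vector_derivative
            (- \<Lambda> (foot t x) * inverse (jac t x)) *\<^sub>R G' (foot t x)) (at t)"
  using vector_diff_chain_at[OF foot_deriv_t[OF assms(1), THEN
      has_real_derivative_iff_has_vector_derivative[THEN iffD1]] G] by (simp add: o_def)

lemma compose_foot_deriv_x:
  fixes G G' :: "real \<Rightarrow> 'b::real_normed_vector"
  assumes "\<bar>t\<bar> \<le> \<tau>" and G: "\<And>y. (G has_vector_derivative G' y) (at y)"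
  shows "((\<lambda>z. G (foot t z)) has_vector_derivative
            inverse (jac t x) *\<^sub>R G' (foot t x)) (at x)"
  using vector_diff_chain_at[OF foot_deriv_x[OF assms(1), THEN
      has_real_derivative_iff_has_vector_derivative[THEN iffD1]] G] by (simp add: o_def)

lemma continuous_inverse_jac:
  assumes "T \<le> \<tau>"
  shows "continuous_on ({0..T} \<times> S) (\<lambda>p. inverse (jac (fst p) (snd p)))"
proof (rule continuous_on_inverse)
  show "continuous_on ({0..T} \<times> S) (\<lambda>p. jac (fst p) (snd p))"
    by (intro continuous_intros continuous_compose_foot cont_deriv_speed)
  show "\<forall>p\<in>{0..T} \<times> S. jac (fst p) (snd p) \<noteq> 0"
  proof
    fix p assume "p \<in> {0..T} \<times> S"
    then have "\<bar>fst p\<bar> \<le> \<tau>" using assms by auto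
    from jac_pos[OF this, of "snd p"] show "jac (fst p) (snd p) \<noteq> 0" by simp
  qed
qed

lemma cont_speed: "continuous_on UNIV \<Lambda>"
  using isCont_speed by (simp add: continuous_at_imp_continuous_on)

text \<open>By \<open>fg\<close>, the time derivative of \<open>g\<close> at the foot and the space
  derivative of \<open>f\<close> at the foot cancel pointwise: \<open>g\<close> is a conserved
  density with flux \<open>f\<close>, and Green's formula leaves only boundary terms.\<close>

lemma transported_balance:
  fixes g g' f f' :: "real \<Rightarrow> 'a::euclidean_space"
  assumes g: "\<And>y. (g has_vector_derivative g' y) (at y)" "continuous_on UNIV g'"
    and f: "\<And>y. (f has_vector_derivative f' y) (at y)"
    and fg: "\<And>y. f' y = \<Lambda> y *\<^sub>R g' y"
    and ts: "0 \<le> s" "s \<le> t" "t < \<tau>" and "\<alpha> \<le> \<beta>"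
  shows "integral {\<alpha>..\<beta>} (\<lambda>x. g (foot t x)) - integral {\<alpha>..\<beta>} (\<lambda>x. g (foot s x)) =
    - integral {s..t} (\<lambda>r. f (foot r \<beta>) - f (foot r \<alpha>))"
proof -
  have cg: "continuous_on UNIV g"
    using g(1) by (meson continuous_at_imp_continuous_on has_vector_derivative_continuous)
  have cgx: "(\<lambda>x. g (foot r x)) integrable_on {\<alpha>..\<beta>}" for r
    by (intro integrable_continuous_interval continuous_compose_foot_x cg)
  have cPN: "continuous_on ({s..t} \<times> {\<alpha>..\<beta>})
      (\<lambda>p. (\<Lambda> (foot (fst p) (snd p)) * inverse (jac (fst p) (snd p))) *\<^sub>R g' (foot (fst p) (snd p)))"
    by (rule continuous_on_subset[of "{0..t} \<times> {\<alpha>..\<beta>}"],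
        intro continuous_intros continuous_compose_foot g(2) cont_speed
          continuous_inverse_jac less_imp_le[OF ts(3)]) (use ts in auto)
  have "integral (cbox (s, \<alpha>) (t, \<beta>)) (\<lambda>p.
       (- \<Lambda> (foot (fst p) (snd p)) * inverse (jac (fst p) (snd p))) *\<^sub>R g' (foot (fst p) (snd p))
     + inverse (jac (fst p) (snd p)) *\<^sub>R f' (foot (fst p) (snd p))) =
     integral {\<alpha>..\<beta>} (\<lambda>x. g (foot t x) - g (foot s x))
       + integral {s..t} (\<lambda>r. f (foot r \<beta>) - f (foot r \<alpha>))"
  proof (rule green_rectangle)
    show "continuous_on ({s..t} \<times> {\<alpha>..\<beta>})
      (\<lambda>p. (- \<Lambda> (foot (fst p) (snd p)) * inverse (jac (fst p) (snd p))) *\<^sub>R g' (foot (fst p) (snd p)))"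
      using continuous_on_minus[OF cPN] by simp
    show "continuous_on ({s..t} \<times> {\<alpha>..\<beta>})
      (\<lambda>p. inverse (jac (fst p) (snd p)) *\<^sub>R f' (foot (fst p) (snd p)))"
      using cPN by (simp add: fg mult.commute)
  qed (use ts assms(8) in simp, use assms(8) in simp,
       rule compose_foot_deriv_t[OF _ g(1)], use ts in simp,
       rule compose_foot_deriv_x[OF _ f], use ts in simp)
  then show ?thesis
    by (simp add: fg mult.commute integral_diff[OF cgx cgx] eq_neg_iff_add_eq_0)
qed

lemma transported_weak_form:
  fixes g g' f f' :: "real \<Rightarrow> 'a::euclidean_space"
  assumes g: "\<And>y. (g has_vector_derivative g' y) (at y)" "continuous_on UNIV g'"
    and f: "\<And>y. (f has_vector_derivative f' y) (at y)"
    and fg: "\<And>y. f' y = \<Lambda> y *\<^sub>R g' y"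
    and T: "0 < T" "T < \<tau>"
    and \<phi>: "test_fn \<phi> \<phi>t \<phi>x"
    and supp: "T' < T" "\<And>t x. \<phi> t x \<noteq> 0 \<Longrightarrow> t \<le> T' \<and> \<bar>x\<bar> \<le> R"
  shows "(LINT p : {0<..<T} \<times> UNIV | lborel.
            \<phi>t (fst p) (snd p) *\<^sub>R g (foot (fst p) (snd p))
            + \<phi>x (fst p) (snd p) *\<^sub>R f (foot (fst p) (snd p)))
        + (LINT x | lborel. \<phi> 0 x *\<^sub>R g x) = 0"
proof -
  \<comment> \<open>One unit beyond the support, so that the sides of the rectangle lie in the open
    set where \<open>\<phi>\<close>, and hence its partials, vanish.\<close>
  define R' where "R' = \<bar>R\<bar> + 1"
  have R': "R < R'" "0 < R'" by (auto simp: R'_def)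
  have z: "\<phi> t x = 0" if "R < \<bar>x\<bar> \<or> T' < t" for t x
    using supp(2)[of t x] that by force
  have z': "\<phi>t t x = 0" "\<phi>x t x = 0" if "R' \<le> \<bar>x\<bar>" for t x
    using test_fn_partials_eq_0_outside[OF \<phi>, of R x t] z that R' by auto
  have cg: "continuous_on UNIV g" and cf: "continuous_on UNIV f"
    using g(1) f(1) by (meson continuous_at_imp_continuous_on has_vector_derivative_continuous)+
  note cont = test_fn_continuous[OF \<phi>] continuous_compose_foot[OF cg] continuous_compose_foot[OF cf]
    continuous_compose_foot[OF g(2)] continuous_compose_foot[OF cont_speed]
    continuous_inverse_jac[OF less_imp_le[OF T(2)]]
  let ?K = "\<lambda>p. \<phi>t (fst p) (snd p) *\<^sub>R g (foot (fst p) (snd p))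
            + \<phi>x (fst p) (snd p) *\<^sub>R f (foot (fst p) (snd p))"
  \<comment> \<open>\<open>?h\<close> is \<open>\<phi>\<close> times the space derivative of the
    transported flux. Subtracting it from the time part and adding it to the space part makes both
    exact derivatives of products.\<close>
  let ?h = "\<lambda>t x. (\<phi> t x * (\<Lambda> (foot t x) * inverse (jac t x))) *\<^sub>R g' (foot t x)"
  have "(LINT p : {0<..<T} \<times> UNIV | lborel. ?K p) = integral (cbox (0, -R') (T, R')) ?K"
    by (rule strip_integral_eq_integral_cbox) (intro continuous_intros cont, simp add: z')
  also have "\<dots> = integral (cbox (0, -R') (T, R')) (\<lambda>p.
      (\<phi>t (fst p) (snd p) *\<^sub>R g (foot (fst p) (snd p)) - ?h (fst p) (snd p))
      + (\<phi>x (fst p) (snd p) *\<^sub>R f (foot (fst p) (snd p)) + ?h (fst p) (snd p)))"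
    by simp
  also have "\<dots> = integral {-R'..R'} (\<lambda>x. \<phi> T x *\<^sub>R g (foot T x) - \<phi> 0 x *\<^sub>R g (foot 0 x))
     + integral {0..T} (\<lambda>t. \<phi> t R' *\<^sub>R f (foot t R') - \<phi> t (-R') *\<^sub>R f (foot t (-R')))"
  proof (rule green_rectangle)
    fix t x assume "t \<in> {0..T}" "x \<in> {-R'..R'}"
    then have t: "\<bar>t\<bar> < \<tau>" using T by auto
    show "((\<lambda>r. \<phi> r x *\<^sub>R g (foot r x)) has_vector_derivative
        \<phi>t t x *\<^sub>R g (foot t x) - ?h t x) (at t)"
      by (rule has_vector_derivative_eq_rhs, rule has_vector_derivative_scaleR,
          rule test_fn_partials(1)[OF \<phi>], rule compose_foot_deriv_t[OF t g(1)]) simp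
    show "((\<lambda>z. \<phi> t z *\<^sub>R f (foot t z)) has_vector_derivative
        \<phi>x t x *\<^sub>R f (foot t x) + ?h t x) (at x)"
      by (rule has_vector_derivative_eq_rhs, rule has_vector_derivative_scaleR,
          rule test_fn_partials(2)[OF \<phi>], rule compose_foot_deriv_x[OF less_imp_le[OF t] f(1)])
         (simp add: fg mult_ac)
  qed (use T R' in simp, use R' in simp, (intro continuous_intros cont)+)
  also have "\<dots> = - integral {-R'..R'} (\<lambda>x. \<phi> 0 x *\<^sub>R g x)"
    using z[of R'] z[of "-R'"] z[of _ T] supp(1) R' by simp
  finally have 1: "(LINT p : {0<..<T} \<times> UNIV | lborel. ?K p) =
     - integral {-R'..R'} (\<lambda>x. \<phi> 0 x *\<^sub>R g x)" .
  have "continuous_on {-R'..R'} (\<lambda>x. \<phi> 0 x)"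
  proof -
    have "continuous_on {-R'..R'} (\<lambda>x. (0::real, x))" by (intro continuous_intros)
    from continuous_on_compose2[OF test_fn_continuous(1)[OF \<phi>, of UNIV] this]
    show ?thesis by simp
  qed
  then have "set_integrable lborel {-R'..R'} (\<lambda>x. \<phi> 0 x *\<^sub>R g x)"
    by (intro borel_integrable_atLeastAtMost' continuous_intros continuous_on_subset[OF cg]) auto
  then have "integral {-R'..R'} (\<lambda>x. \<phi> 0 x *\<^sub>R g x) = (LINT x : {-R'..R'} | lborel. \<phi> 0 x *\<^sub>R g x)"
    by (simp add: set_borel_integral_eq_integral)
  also have "\<dots> = (LINT x | lborel. \<phi> 0 x *\<^sub>R g x)"
    unfolding set_lebesgue_integral_def
  proof (rule Bochner_Integration.integral_cong)
    show "indicator {-R'..R'} x *\<^sub>R \<phi> 0 x *\<^sub>R g x = \<phi> 0 x *\<^sub>R g x" for x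
      using z[of x 0] R' by (cases "x \<in> {-R'..R'}") auto
  qed simp
  finally show ?thesis using 1 by simp
qed

text \<open>The solution is C1, so its distributional gradient has a continuous density. Integration
  by parts moves the derivatives onto \<open>u\<close>, and the bound is the integral of the norms
  of both partials over a box containing \<open>K\<close>. All boundary terms vanish because
  \<open>K\<close> lies in the open strip.\<close>

lemma transported_BV_loc:
  fixes g g' :: "real \<Rightarrow> state"
  assumes g: "\<And>y. (g has_vector_derivative g' y) (at y)" "continuous_on UNIV g'"
    and T: "0 < T" "T < \<tau>"
    and u: "\<And>t x. u t x = g (foot t x)"
  shows "BV_loc T u"
  unfolding BV_loc_def
proof (intro allI impI, elim conjE)
  fix K :: "(real \<times> real) set"
  assume K: "compact K" "K \<subseteq> {0<..<T} \<times> UNIV"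
  obtain R where R: "\<And>p. p \<in> K \<Longrightarrow> norm p \<le> R"
    using compact_imp_bounded[OF K(1)] unfolding bounded_iff by blast
  define R' where "R' = \<bar>R\<bar> + 1"
  have KR: "\<bar>x\<bar> \<le> \<bar>R\<bar>" if "(t, x) \<in> K" for t x
    using R[OF that] norm_snd_le[of x t] by (simp del: norm_Pair)
  have cg: "continuous_on UNIV g"
    using g(1) by (meson continuous_at_imp_continuous_on has_vector_derivative_continuous)
  let ?box = "cbox (0, -R') (T, R') :: (real \<times> real) set"
  have box: "?box = {0..T} \<times> {-R'..R'}" by (auto simp: cbox_Pair_eq)
  let ?gt = "\<lambda>t x. (\<Lambda> (foot t x) * inverse (jac t x)) *\<^sub>R g' (foot t x)"
  let ?gx = "\<lambda>t x. inverse (jac t x) *\<^sub>R g' (foot t x)"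
  note cont = continuous_compose_foot[OF cg]
    continuous_compose_foot[OF g(2)] continuous_compose_foot[OF cont_speed]
    continuous_inverse_jac[OF less_imp_le[OF T(2)]]
  let ?M = "\<lambda>p. norm (?gt (fst p) (snd p)) + norm (?gx (fst p) (snd p))"
  have cM: "continuous_on ?box ?M"
    unfolding box by (intro continuous_intros cont)
  show "\<exists>M. \<forall>\<psi>1 \<psi>1t \<psi>1x \<psi>2 \<psi>2t \<psi>2x.
          test_fn \<psi>1 \<psi>1t \<psi>1x \<and> test_fn \<psi>2 \<psi>2t \<psi>2x \<and>
          (\<forall>t x. (t, x) \<notin> K \<longrightarrow> \<psi>1 t x = 0 \<and> \<psi>2 t x = 0) \<and>
          (\<forall>t x. (\<psi>1 t x)\<^sup>2 + (\<psi>2 t x)\<^sup>2 \<le> 1) \<longrightarrow>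
          norm (LINT p : {0<..<T} \<times> UNIV | lborel.
                  (\<psi>1t (fst p) (snd p) + \<psi>2x (fst p) (snd p)) *\<^sub>R u (fst p) (snd p)) \<le> M"
  proof (intro exI allI impI, elim conjE)
    fix \<psi>1 \<psi>1t \<psi>1x \<psi>2 \<psi>2t \<psi>2x
    assume t1: "test_fn \<psi>1 \<psi>1t \<psi>1x" and t2: "test_fn \<psi>2 \<psi>2t \<psi>2x"
      and zero: "\<forall>t x. (t, x) \<notin> K \<longrightarrow> \<psi>1 t x = 0 \<and> \<psi>2 t x = 0"
      and le1: "\<forall>t x. (\<psi>1 t x)\<^sup>2 + (\<psi>2 t x)\<^sup>2 \<le> 1"
    have z: "\<psi>1 t x = 0 \<and> \<psi>2 t x = 0" if "\<bar>R\<bar> < \<bar>x\<bar> \<or> t \<le> 0 \<or> T \<le> t" for t x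
      using zero KR[of t x] K(2) that by fastforce
    have z': "\<psi>1t t x = 0" "\<psi>2x t x = 0" if "R' \<le> \<bar>x\<bar>" for t x
      using test_fn_partials_eq_0_outside[OF t1, of "\<bar>R\<bar>" x t]
        test_fn_partials_eq_0_outside[OF t2, of "\<bar>R\<bar>" x t] z that by (auto simp: R'_def)
    have abs1: "\<bar>\<psi>1 t x\<bar> \<le> 1" "\<bar>\<psi>2 t x\<bar> \<le> 1" for t x
      using le1[rule_format, of t x] zero_le_power2[of "\<psi>1 t x"] zero_le_power2[of "\<psi>2 t x"]
      unfolding abs_square_le_1[symmetric] by linarith+
    note cont' = test_fn_continuous[OF t1] test_fn_continuous[OF t2] cont
    let ?W = "\<lambda>p. (- \<psi>1 (fst p) (snd p)) *\<^sub>R ?gt (fst p) (snd p)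
       + \<psi>2 (fst p) (snd p) *\<^sub>R ?gx (fst p) (snd p)"
    let ?V = "\<lambda>p. (\<psi>1t (fst p) (snd p) + \<psi>2x (fst p) (snd p)) *\<^sub>R g (foot (fst p) (snd p))"
    have cV: "continuous_on ?box ?V" and cW: "continuous_on ?box ?W"
      unfolding box by (intro continuous_intros cont')+
    have "integral ?box (\<lambda>p.
        (\<psi>1t (fst p) (snd p) *\<^sub>R g (foot (fst p) (snd p)) - \<psi>1 (fst p) (snd p) *\<^sub>R ?gt (fst p) (snd p))
      + (\<psi>2x (fst p) (snd p) *\<^sub>R g (foot (fst p) (snd p)) + \<psi>2 (fst p) (snd p) *\<^sub>R ?gx (fst p) (snd p)))
      = integral {-R'..R'} (\<lambda>x. \<psi>1 T x *\<^sub>R g (foot T x) - \<psi>1 0 x *\<^sub>R g (foot 0 x))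
     + integral {0..T} (\<lambda>t. \<psi>2 t R' *\<^sub>R g (foot t R') - \<psi>2 t (-R') *\<^sub>R g (foot t (-R')))"
    proof (rule green_rectangle[where P = "\<lambda>t x. \<psi>1 t x *\<^sub>R g (foot t x)" and
          N = "\<lambda>t x. \<psi>2 t x *\<^sub>R g (foot t x)" and
          Pt = "\<lambda>t x. \<psi>1t t x *\<^sub>R g (foot t x) - \<psi>1 t x *\<^sub>R ?gt t x" and
          Nx = "\<lambda>t x. \<psi>2x t x *\<^sub>R g (foot t x) + \<psi>2 t x *\<^sub>R ?gx t x"])
      fix t x assume "t \<in> {0..T}" "x \<in> {-R'..R'}"
      then have t: "\<bar>t\<bar> < \<tau>" using T by auto
      show "((\<lambda>r. \<psi>1 r x *\<^sub>R g (foot r x)) has_vector_derivative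
          \<psi>1t t x *\<^sub>R g (foot t x) - \<psi>1 t x *\<^sub>R ?gt t x) (at t)"
        by (rule has_vector_derivative_eq_rhs, rule has_vector_derivative_scaleR,
            rule test_fn_partials(1)[OF t1], rule compose_foot_deriv_t[OF t g(1)]) simp
      show "((\<lambda>z. \<psi>2 t z *\<^sub>R g (foot t z)) has_vector_derivative
          \<psi>2x t x *\<^sub>R g (foot t x) + \<psi>2 t x *\<^sub>R ?gx t x) (at x)"
        by (rule has_vector_derivative_eq_rhs, rule has_vector_derivative_scaleR,
            rule test_fn_partials(2)[OF t2], rule compose_foot_deriv_x[OF less_imp_le[OF t] g(1)])
           (rule add.commute)
    qed (use T in simp, simp add: R'_def, (intro continuous_intros cont')+)
    also have "\<dots> = 0"
      using z[of R'] z[of "-R'"] z[of _ 0] z[of _ T] by (simp add: R'_def)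
    finally have "integral ?box (\<lambda>p. ?V p + ?W p) = 0"
      by (simp add: scaleR_add_left diff_conv_add_uminus add_ac del: add_uminus_conv_diff)
    then have eq: "integral ?box ?V = - integral ?box ?W"
      using integrable_continuous[OF cV] integrable_continuous[OF cW]
      by (simp add: integral_add eq_neg_iff_add_eq_0)
    have lint: "(LINT p : {0<..<T} \<times> UNIV | lborel.
            (\<psi>1t (fst p) (snd p) + \<psi>2x (fst p) (snd p)) *\<^sub>R u (fst p) (snd p)) = integral ?box ?V"
      unfolding u
      by (rule strip_integral_eq_integral_cbox[OF cV[unfolded box]]) (simp add: z')
    have "norm (integral ?box ?W) \<le> integral ?box ?M"
    proof (rule integral_norm_bound_integral)
      fix p assume "p \<in> ?box"
      have "norm (?W p) \<le> \<bar>\<psi>1 (fst p) (snd p)\<bar> * norm (?gt (fst p) (snd p))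
         + \<bar>\<psi>2 (fst p) (snd p)\<bar> * norm (?gx (fst p) (snd p))"
        unfolding norm_scaleR[symmetric]
        using norm_triangle_ineq[of "(- \<psi>1 (fst p) (snd p)) *\<^sub>R ?gt (fst p) (snd p)"
            "\<psi>2 (fst p) (snd p) *\<^sub>R ?gx (fst p) (snd p)"] by simp
      also have "\<dots> \<le> 1 * norm (?gt (fst p) (snd p)) + 1 * norm (?gx (fst p) (snd p))"
        by (intro add_mono mult_right_mono abs1) auto
      finally show "norm (?W p) \<le> ?M p" by simp
    qed (rule integrable_continuous[OF cW], rule integrable_continuous[OF cM])
    then show "norm (LINT p : {0<..<T} \<times> UNIV | lborel.
            (\<psi>1t (fst p) (snd p) + \<psi>2x (fst p) (snd p)) *\<^sub>R u (fst p) (snd p)) \<le> integral ?box ?M"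
      unfolding lint eq norm_minus_cancel .
  qed
qed

end

section \<open>Relative entropy of the Euler system\<close>

text \<open>The conservative state with given density, velocity and pressure, where rho e = p /
  (\<gamma> - 1). A contact leaves velocity and pressure unchanged, and acoustic curves are explicit
  in these variables.\<close>

definition prim :: "real \<Rightarrow> real \<Rightarrow> real \<Rightarrow> real \<Rightarrow> state" where
  "prim \<gamma> \<rho> v p = (\<rho>, \<rho> * v, \<rho> * v\<^sup>2 / 2 + p / (\<gamma> - 1))"

lemma rho_prim [simp]: "rho (prim \<gamma> \<rho> v p) = \<rho>"
  by (simp add: prim_def rho_def)

lemma vel_prim [simp]: "\<rho> \<noteq> 0 \<Longrightarrow> vel (prim \<gamma> \<rho> v p) = v"
  by (simp add: prim_def rho_def vel_def mom_def)

lemma inte_prim: "\<rho> \<noteq> 0 \<Longrightarrow> inte (prim \<gamma> \<rho> v p) = p / ((\<gamma> - 1) * \<rho>)"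
  by (simp add: prim_def rho_def inte_def mom_def energy_def power_mult_distrib add_divide_distrib)

lemma pres_prim [simp]: "\<rho> \<noteq> 0 \<Longrightarrow> \<gamma> \<noteq> 1 \<Longrightarrow> pres \<gamma> (prim \<gamma> \<rho> v p) = p"
  by (simp add: pres_def inte_prim)

lemma prim_in_phys_states: "\<gamma> > 1 \<Longrightarrow> \<rho> > 0 \<Longrightarrow> p > 0 \<Longrightarrow> prim \<gamma> \<rho> v p \<in> phys_states"
  by (simp add: phys_states_def inte_prim)

lemma mom_eq: "rho u \<noteq> 0 \<Longrightarrow> mom u = rho u * vel u"
  by (simp add: vel_def)

lemma energy_eq: "rho u \<noteq> 0 \<Longrightarrow> energy u = rho u * ((vel u)\<^sup>2 / 2 + inte u)"
  by (simp add: vel_def inte_def power_divide algebra_simps)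

lemma state_eq_prim:
  assumes "\<gamma> \<noteq> 1" "rho u \<noteq> 0"
  shows "u = prim \<gamma> (rho u) (vel u) (pres \<gamma> u)"
proof -
  have "u = (rho u, mom u, energy u)"
    by (simp add: rho_def mom_def energy_def)
  also have "\<dots> = prim \<gamma> (rho u) (vel u) (pres \<gamma> u)"
    using assms by (simp add: prim_def mom_eq energy_eq pres_def mult.assoc)
      (simp add: algebra_simps)
  finally show ?thesis .
qed

lemma flux_prim:
  "\<rho> \<noteq> 0 \<Longrightarrow> \<gamma> \<noteq> 1 \<Longrightarrow> flux \<gamma> (prim \<gamma> \<rho> v p) =
     (\<rho> * v, \<rho> * v\<^sup>2 + p, (\<rho> * v\<^sup>2 / 2 + p / (\<gamma> - 1) + p) * v)"
  by (simp add: flux_def mom_eq) (simp add: prim_def energy_def power2_eq_square)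

lemma entropy_prim:
  assumes "\<gamma> > 1" "\<rho> > 0" "p > 0"
  shows "entropy \<gamma> (prim \<gamma> \<rho> v p) = \<rho> * (\<gamma> * ln \<rho> - ln p + ln (\<gamma> - 1))"
  using assms by (simp add: entropy_def inte_prim ln_div ln_mult) (simp add: algebra_simps)

text \<open>The gradient of the entropy at \<open>w\<close> applied to \<open>d\<close>, with
  coefficients in terms of density, velocity and internal energy of \<open>w\<close>.\<close>

definition entropy_diff :: "real \<Rightarrow> state \<Rightarrow> state \<Rightarrow> real" where
  "entropy_diff \<gamma> w d =
     ((\<gamma> - 1) * (ln (rho w) + 1) - ln (inte w) + 1 - (vel w)\<^sup>2 / (2 * inte w)) * rho d
     + vel w / inte w * mom d - energy d / inte w"

lemma entropy_has_derivative:
  assumes "w \<in> phys_states"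
  shows "(entropy \<gamma> has_derivative entropy_diff \<gamma> w) (at w)"
proof -
  obtain r q e where w: "w = (r, q, e)" by (cases w)
  have r: "r > 0" and i: "e / r - q\<^sup>2 / (2 * r\<^sup>2) > 0"
    using assms by (auto simp: phys_states_def w rho_def inte_def energy_def mom_def)
  define I where "I = e / r - q\<^sup>2 / (2 * r\<^sup>2)"
  have I: "I > 0" using i by (simp add: I_def)
  have ee: "e = r * I + q\<^sup>2 / (2 * r)"
    using r by (simp add: I_def field_simps power2_eq_square)
  have dI: "(inte has_derivative
     (\<lambda>d. energy d / r - e * rho d / r\<^sup>2 - q * mom d / r\<^sup>2 + q\<^sup>2 * rho d / r ^ 3)) (at w)"
    unfolding inte_def[abs_def] rho_def mom_def energy_def w
    by (rule derivative_eq_intros | use r in simp)+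
       (use r in \<open>auto simp: fun_eq_iff field_simps power2_eq_square power3_eq_cube\<close>)
  have dr: "(rho has_derivative rho) (at w)"
    unfolding rho_def[abs_def] by (auto intro!: derivative_eq_intros)
  have rw: "rho w = r" "inte w = I"
    by (simp_all add: w rho_def mom_def energy_def I_def inte_def)
  have "((\<lambda>u. (\<gamma> - 1) * rho u * ln (rho u) - rho u * ln (inte u)) has_derivative
     (\<lambda>d. (\<gamma> - 1) * rho d * ln r + (\<gamma> - 1) * rho d - rho d * ln I
       - r * ((energy d / r - e * rho d / r\<^sup>2 - q * mom d / r\<^sup>2 + q\<^sup>2 * rho d / r ^ 3) / I))) (at w)"
    by (rule derivative_eq_intros dI dr | simp add: rw I r)+
       (use r I in \<open>simp add: fun_eq_iff rw field_simps\<close>)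
  moreover have "(\<gamma> - 1) * rho d * ln r + (\<gamma> - 1) * rho d - rho d * ln I
       - r * ((energy d / r - e * rho d / r\<^sup>2 - q * mom d / r\<^sup>2 + q\<^sup>2 * rho d / r ^ 3) / I)
     = entropy_diff \<gamma> w d" for d
  proof -
    have vw: "vel w = q / r" "inte w = I" "rho w = r"
      by (simp_all add: vel_def rw) (simp add: w mom_def)
    show ?thesis
      unfolding entropy_diff_def vw ee using r I
      by (simp add: field_simps power2_eq_square power3_eq_cube)
  qed
  ultimately show ?thesis
    by (simp add: entropy_def[abs_def])
qed

lemma bounded_linear_entropy_diff:
  "w \<in> phys_states \<Longrightarrow> bounded_linear (entropy_diff \<gamma> w)"
  using entropy_has_derivative has_derivative_bounded_linear by blast

lemma rel_entropy_eq:
  assumes "w \<in> phys_states"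
  shows "rel_entropy \<gamma> u w = entropy \<gamma> u - entropy_diff \<gamma> w u + (\<gamma> - 1) * rho w"
proof -
  have "frechet_derivative (entropy \<gamma>) (at w) = entropy_diff \<gamma> w"
    using frechet_derivative_at[OF entropy_has_derivative[OF assms]] by simp
  moreover have "entropy_diff \<gamma> w (u - w) = entropy_diff \<gamma> w u - entropy_diff \<gamma> w w"
    using bounded_linear_entropy_diff[OF assms] by (simp add: bounded_linear.linear linear_diff)
  \<comment> \<open>Euler's relation with a defect: the entropy is homogeneous of degree one except
    for the logarithm of the density, which contributes
    \<open>(\<gamma> - 1) * rho w\<close>.\<close>
  moreover have "entropy_diff \<gamma> w w = entropy \<gamma> w + (\<gamma> - 1) * rho w"
    using assms by (simp add: entropy_diff_def entropy_def phys_states_def mom_eq energy_eq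
        field_simps power2_eq_square)
  ultimately show ?thesis by (simp add: rel_entropy_def)
qed

text \<open>Density, internal energy and kinetic parts; for \<open>\<gamma> > 1\<close> each is
  nonnegative.\<close>

lemma rel_entropy_formula:
  assumes "w \<in> phys_states" "u \<in> phys_states"
  shows "rel_entropy \<gamma> u w = (\<gamma> - 1) * (rho u * ln (rho u / rho w) - rho u + rho w)
    + rho u * (inte u / inte w - 1 - ln (inte u / inte w))
    + rho u * (vel u - vel w)\<^sup>2 / (2 * inte w)"
proof -
  have "rho u > 0" "rho w > 0" "inte u > 0" "inte w > 0"
    using assms by (auto simp: phys_states_def)
  then show ?thesis
    using assms(1)
    by (simp add: rel_entropy_eq entropy_def entropy_diff_def mom_eq energy_eq ln_div
        field_simps power2_eq_square)
qed

lemma relative_log_nonneg: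
  assumes "(r::real) > 0" "s > 0"
  shows "0 \<le> r * ln (r / s) - r + s"
proof -
  have "ln (s / r) \<le> s / r - 1" using assms by (intro ln_le_minus_one) simp
  then have "r * ln (s / r) \<le> r * (s / r - 1)" using assms by (intro mult_left_mono) auto
  then show ?thesis using assms by (simp add: ln_div algebra_simps)
qed

lemma relative_log_pos:
  assumes "(r::real) > 0" "s > 0" "r \<noteq> s"
  shows "0 < r * ln (r / s) - r + s"
proof -
  have "ln (s / r) \<noteq> s / r - 1"
    using ln_eq_minus_one[of "s / r"] assms by auto
  then have "ln (s / r) < s / r - 1"
    using ln_le_minus_one[of "s / r"] assms by simp
  then have "r * ln (s / r) < r * (s / r - 1)" using assms by (intro mult_strict_left_mono) auto
  then show ?thesis using assms by (simp add: ln_div algebra_simps)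
qed

lemma rel_entropy_ge:
  assumes "w \<in> phys_states" "u \<in> phys_states"
  shows "(\<gamma> - 1) * (rho u * ln (rho u / rho w) - rho u + rho w) \<le> rel_entropy \<gamma> u w"
proof -
  have *: "rho u > 0" "rho w > 0" "inte u > 0" "inte w > 0"
    using assms by (auto simp: phys_states_def)
  then have "ln (inte u / inte w) \<le> inte u / inte w - 1"
    by (intro ln_le_minus_one) simp
  then have "0 \<le> rho u * (inte u / inte w - 1 - ln (inte u / inte w))"
    using * by (intro mult_nonneg_nonneg) auto
  moreover have "0 \<le> rho u * (vel u - vel w)\<^sup>2 / (2 * inte w)"
    using * by simp
  ultimately show ?thesis
    unfolding rel_entropy_formula[OF assms] by linarith
qed

lemma rel_entropy_nonneg:
  assumes "\<gamma> > 1" "w \<in> phys_states" "u \<in> phys_states"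
  shows "0 \<le> rel_entropy \<gamma> u w"
  using rel_entropy_ge[OF assms(2,3), of \<gamma>] relative_log_nonneg[of "rho u" "rho w"] assms
  by (smt (verit) mult_nonneg_nonneg mem_Collect_eq phys_states_def)

text \<open>Strictness comes from the density part alone. This suffices for the two sides of a
  contact: equal pressures and different internal energies force different densities.\<close>

lemma rel_entropy_pos:
  assumes "\<gamma> > 1" "w \<in> phys_states" "u \<in> phys_states" "rho u \<noteq> rho w"
  shows "0 < rel_entropy \<gamma> u w"
  using rel_entropy_ge[OF assms(2,3), of \<gamma>] relative_log_pos[of "rho u" "rho w"] assms
  by (smt (verit) mult_pos_pos mem_Collect_eq phys_states_def)

lemma rel_entropy_self: "w \<in> phys_states \<Longrightarrow> rel_entropy \<gamma> w w = 0"
  by (simp add: rel_entropy_formula phys_states_def)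

text \<open>The flux paired with \<open>rel_entropy\<close>, without the constant that would make it
  vanish at \<open>w\<close>; only differences of its values enter the balance laws.\<close>

definition rel_flux :: "real \<Rightarrow> state \<Rightarrow> state \<Rightarrow> real" where
  "rel_flux \<gamma> w u = entropy_flux \<gamma> u - entropy_diff \<gamma> w (flux \<gamma> u)"

lemma rel_flux_diff:
  assumes "\<gamma> \<noteq> 1" "w \<in> phys_states" "u \<in> phys_states"
  shows "rel_flux \<gamma> w u - rel_flux \<gamma> w w =
    vel u * rel_entropy \<gamma> u w + (vel u - vel w) * (pres \<gamma> u - pres \<gamma> w) / inte w"
proof -
  have *: "rho u > 0" "rho w > 0" "inte u > 0" "inte w > 0"
    using assms by (auto simp: phys_states_def)
  have F: "rho (flux \<gamma> x) = rho x * vel x" "mom (flux \<gamma> x) = rho x * (vel x)\<^sup>2 + pres \<gamma> x"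
    "energy (flux \<gamma> x) = (rho x * ((vel x)\<^sup>2 / 2 + inte x) + pres \<gamma> x) * vel x"
    if "rho x > 0" for x
    using that by (simp_all add: flux_def rho_def[of "(_, _)"] mom_def[of "(_, _)"]
        energy_def[of "(_, _)"] mom_eq energy_eq power2_eq_square)
  show ?thesis
    unfolding rel_flux_def entropy_flux_def rel_entropy_eq[OF assms(2)]
      entropy_diff_def F[OF *(1)] F[OF *(2)] entropy_def mom_eq[OF less_imp_neq[OF *(1), symmetric]]
      energy_eq[OF less_imp_neq[OF *(1), symmetric]] pres_def
    using * by (simp add: field_simps power2_eq_square)
qed

text \<open>Allows the convex hull of the values of the solution as the set \<open>U\<close>. For
  positive density, positivity of the internal energy reads \<open>2 * r * e > q * q\<close>, which
  describes a convex cone.\<close>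

lemma convex_phys_states: "convex phys_states"
proof (rule convexI)
  fix x y :: state and s t :: real
  assume x: "x \<in> phys_states" and y: "y \<in> phys_states" and st: "0 \<le> s" "0 \<le> t" "s + t = 1"
  obtain a b c where xx: "x = (a, b, c)" by (cases x)
  obtain a' b' c' where yy: "y = (a', b', c')" by (cases y)
  have iff: "(r, q, e) \<in> phys_states \<longleftrightarrow> r > 0 \<and> 2 * r * e - q\<^sup>2 > 0" for r q e :: real
  proof -
    have "0 < e / r - q\<^sup>2 / (2 * r\<^sup>2) \<longleftrightarrow> 0 < 2 * r * e - q\<^sup>2" if "r > 0"
    proof -
      have "e / r - q\<^sup>2 / (2 * r\<^sup>2) = (2 * r * e - q\<^sup>2) / (2 * r\<^sup>2)"
        using that by (simp add: field_simps power2_eq_square)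
      then show ?thesis using that by (simp only: zero_less_divide_iff) simp
    qed
    then show ?thesis
      by (auto simp: phys_states_def rho_def inte_def mom_def energy_def)
  qed
  have 1: "a > 0" "a' > 0" "2 * a * c - b\<^sup>2 > 0" "2 * a' * c' - b'\<^sup>2 > 0"
    using x y unfolding xx yy iff by auto
  have pos: "s * a + t * a' > 0"
    using 1 st by (smt (verit) mult_nonneg_nonneg mult_pos_pos)
  have cross: "2 * (a * c' + a' * c - b * b') > 0"
  proof -
    \<comment> \<open>Multiplying by \<open>2 * a * a'\<close> completes the square: a reversed
      Cauchy-Schwarz inequality inside the cone.\<close>
    have "2 * a * a' * (a * c' + a' * c - b * b') =
      a\<^sup>2 * (2 * a' * c' - b'\<^sup>2) + a'\<^sup>2 * (2 * a * c - b\<^sup>2) + (a * b' - a' * b)\<^sup>2"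
      by (simp add: algebra_simps power2_eq_square)
    moreover have "(a * b' - a' * b)\<^sup>2 \<ge> 0" by simp
    moreover have "a\<^sup>2 * (2 * a' * c' - b'\<^sup>2) > 0" "a'\<^sup>2 * (2 * a * c - b\<^sup>2) > 0"
      using 1 by auto
    ultimately have "2 * a * a' * (a * c' + a' * c - b * b') > 0" by linarith
    then have "a * c' + a' * c - b * b' > 0"
      by (rule zero_less_mult_pos) (use 1 in simp)
    then show ?thesis by simp
  qed
  have "2 * (s * a + t * a') * (s * c + t * c') - (s * b + t * b')\<^sup>2 =
    s\<^sup>2 * (2 * a * c - b\<^sup>2) + t\<^sup>2 * (2 * a' * c' - b'\<^sup>2) + s * t * (2 * (a * c' + a' * c - b * b'))"
    by (simp add: algebra_simps power2_eq_square)
  moreover have "\<dots> > 0"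
  proof (cases "s = 0")
    case True then show ?thesis using 1 st by simp
  next
    case False
    then have "s\<^sup>2 * (2 * a * c - b\<^sup>2) > 0" using 1 st by simp
    moreover have "t\<^sup>2 * (2 * a' * c' - b'\<^sup>2) \<ge> 0" using 1 by simp
    moreover have "s * t * (2 * (a * c' + a' * c - b * b')) \<ge> 0" using cross st by simp
    ultimately show ?thesis by linarith
  qed
  ultimately show "s *\<^sub>R x + t *\<^sub>R y \<in> phys_states"
    using pos by (simp add: xx yy iff)
qed

section \<open>Euler flows transported along straight characteristics\<close>

text \<open>Under transport along the characteristics every time derivative equals
  \<open>- \<Lambda>\<close> times the space derivative, so the Euler equations in primitive
  variables become the last three conditions. At each point they allow constant states with any
  speed, a pure density change with \<open>\<Lambda> = v\<close>, or an acoustic direction with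
  \<open>\<Lambda>\<close> differing from \<open>v\<close> by the sound speed.\<close>

locale euler_profile = characteristics \<Lambda> \<Lambda>' L B \<tau>
  for \<Lambda> \<Lambda>' :: "real \<Rightarrow> real" and L B \<tau> :: real +
  fixes \<gamma> :: real and r r' v v' p p' :: "real \<Rightarrow> real"
  assumes gamma: "1 < \<gamma>"
    and r: "\<And>y. (r has_real_derivative r' y) (at y)" "continuous_on UNIV r'" "\<And>y. 0 < r y"
    and v: "\<And>y. (v has_real_derivative v' y) (at y)" "continuous_on UNIV v'"
    and p: "\<And>y. (p has_real_derivative p' y) (at y)" "continuous_on UNIV p'" "\<And>y. 0 < p y"
    and mass: "\<And>y. (v y - \<Lambda> y) * r' y + r y * v' y = 0"
    and momentum: "\<And>y. r y * (v y - \<Lambda> y) * v' y + p' y = 0"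
    and pressure: "\<And>y. (v y - \<Lambda> y) * p' y + \<gamma> * p y * v' y = 0"
begin

definition profile :: "real \<Rightarrow> state" where
  "profile y = prim \<gamma> (r y) (v y) (p y)"

definition profile' :: "real \<Rightarrow> state" where
  "profile' y = (r' y, r' y * v y + r y * v' y,
     r' y * (v y)\<^sup>2 / 2 + r y * v y * v' y + p' y / (\<gamma> - 1))"

definition flow :: "real \<Rightarrow> real \<Rightarrow> state" where
  "flow t x = profile (foot t x)"

lemma profile_phys: "profile y \<in> phys_states"
  unfolding profile_def using gamma r(3) p(3) by (intro prim_in_phys_states) auto

lemma continuous_prims: "continuous_on UNIV r" "continuous_on UNIV v" "continuous_on UNIV p"
  using r(1) v(1) p(1) by (meson DERIV_isCont continuous_at_imp_continuous_on)+

lemma profile_deriv: "(profile has_vector_derivative profile' y) (at y)"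
proof -
  note D = r(1)[of y] v(1)[of y] p(1)[of y]
  have "((\<lambda>y. r y * v y) has_real_derivative r' y * v y + r y * v' y) (at y)"
    by (rule derivative_eq_intros D refl)+ (simp add: algebra_simps)
  moreover have "((\<lambda>y. r y * (v y)\<^sup>2 / 2 + p y / (\<gamma> - 1)) has_real_derivative
      r' y * (v y)\<^sup>2 / 2 + r y * v y * v' y + p' y / (\<gamma> - 1)) (at y)"
    by (intro DERIV_add DERIV_cdivide D)
       (auto intro!: derivative_eq_intros D simp: algebra_simps power2_eq_square)
  ultimately show ?thesis
    unfolding profile_def[abs_def] profile'_def prim_def using D(1)
    by (intro has_vector_derivative_Pair) (simp_all add: has_real_derivative_iff_has_vector_derivative)
qed

lemma continuous_profile': "continuous_on UNIV profile'"
  unfolding profile'_def[abs_def]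
  by (intro continuous_intros r v p continuous_prims) (use gamma in auto)

lemma continuous_profile: "continuous_on UNIV profile"
  using profile_deriv by (meson continuous_at_imp_continuous_on has_vector_derivative_continuous)

lemma flux_profile_deriv:
  "((\<lambda>y. flux \<gamma> (profile y)) has_vector_derivative \<Lambda> y *\<^sub>R profile' y) (at y)"
proof -
  note D = r(1)[of y] v(1)[of y] p(1)[of y]
  have eq: "(\<lambda>y. flux \<gamma> (profile y)) = (\<lambda>y. (r y * v y, r y * (v y)\<^sup>2 + p y,
      (r y * (v y)\<^sup>2 / 2 + p y / (\<gamma> - 1) + p y) * v y))"
    using r(3) gamma unfolding profile_def by (subst flux_prim) (auto simp: less_imp_neq[symmetric])
  have m: "r y * v' y = \<Lambda> y * r' y - v y * r' y"
    using mass[of y] by (simp add: algebra_simps)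
  have 1: "((\<lambda>y. r y * v y) has_real_derivative \<Lambda> y * r' y) (at y)"
    by (rule derivative_eq_intros D refl)+ (use m in \<open>simp add: algebra_simps\<close>)
  have "((\<lambda>y. r y * (v y)\<^sup>2 + p y) has_real_derivative
      r' y * (v y)\<^sup>2 + 2 * r y * v y * v' y + p' y) (at y)"
    by (auto intro!: derivative_eq_intros D simp: algebra_simps)
  moreover have "r' y * (v y)\<^sup>2 + 2 * r y * v y * v' y + p' y = \<Lambda> y * (r' y * v y + r y * v' y)"
    using mass[of y] momentum[of y] by algebra
  ultimately have 2: "((\<lambda>y. r y * (v y)\<^sup>2 + p y) has_real_derivative
      \<Lambda> y * (r' y * v y + r y * v' y)) (at y)" by simp
  define k where "k = 1 / (\<gamma> - 1)"
  have k: "k * (\<gamma> - 1) = 1" using gamma by (simp add: k_def)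
  have "((\<lambda>y. (r y * (v y)\<^sup>2 / 2 + k * p y + p y) * v y) has_real_derivative
      (r' y * (v y)\<^sup>2 / 2 + r y * v y * v' y + k * p' y + p' y) * v y
      + (r y * (v y)\<^sup>2 / 2 + k * p y + p y) * v' y) (at y)"
    by (auto intro!: derivative_eq_intros D simp: algebra_simps power2_eq_square)
  moreover have "(r' y * (v y)\<^sup>2 / 2 + r y * v y * v' y + k * p' y + p' y) * v y
      + (r y * (v y)\<^sup>2 / 2 + k * p y + p y) * v' y
      = \<Lambda> y * (r' y * (v y)\<^sup>2 / 2 + r y * v y * v' y + k * p' y)"
  proof -
    \<comment> \<open>The energy law is v^2/2 times \<open>mass\<close>, plus v times
      \<open>momentum\<close>, plus \<open>pressure\<close> divided by \<gamma> - 1; writing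
      \<open>k\<close> for that quotient keeps the identity polynomial.\<close>
    have "(r' y * (v y)\<^sup>2 / 2 + r y * v y * v' y + k * p' y + p' y) * v y
      + (r y * (v y)\<^sup>2 / 2 + k * p y + p y) * v' y
      - \<Lambda> y * (r' y * (v y)\<^sup>2 / 2 + r y * v y * v' y + k * p' y)
      = (v y)\<^sup>2 / 2 * ((v y - \<Lambda> y) * r' y + r y * v' y)
        + v y * (r y * (v y - \<Lambda> y) * v' y + p' y)
        + k * ((v y - \<Lambda> y) * p' y + \<gamma> * p y * v' y)
        + p y * v' y * (1 - k * (\<gamma> - 1))"
      by (simp add: algebra_simps power2_eq_square)
    then show ?thesis using mass[of y] momentum[of y] pressure[of y] k by simp
  qed
  ultimately have 3: "((\<lambda>y. (r y * (v y)\<^sup>2 / 2 + p y / (\<gamma> - 1) + p y) * v y) has_real_derivative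
      \<Lambda> y * (r' y * (v y)\<^sup>2 / 2 + r y * v y * v' y + p' y / (\<gamma> - 1))) (at y)"
    by (simp add: k_def)
  show ?thesis
    unfolding eq profile'_def scaleR_Pair using 1 2 3
    by (intro has_vector_derivative_Pair) (simp_all add: has_real_derivative_iff_has_vector_derivative)
qed

definition entropy' :: "real \<Rightarrow> real" where
  "entropy' y = r' y * (\<gamma> * ln (r y) + \<gamma> - ln (p y) + ln (\<gamma> - 1)) - r y * p' y / p y"

lemma entropy_profile: "entropy \<gamma> (profile y) = r y * (\<gamma> * ln (r y) - ln (p y) + ln (\<gamma> - 1))"
  unfolding profile_def using gamma r(3) p(3) by (intro entropy_prim)

lemma entropy_profile_deriv:
  "((\<lambda>y. entropy \<gamma> (profile y)) has_real_derivative entropy' y) (at y)"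
proof -
  have "r y > 0" "p y > 0" using r(3) p(3) by auto
  then show ?thesis
    unfolding entropy_profile entropy'_def
    by (auto intro!: derivative_eq_intros r(1) p(1) simp: field_simps)
qed

lemma continuous_entropy': "continuous_on UNIV entropy'"
  unfolding entropy'_def[abs_def]
  by (intro continuous_intros r(2) p(2) continuous_prims)
     (use r(3) p(3) in \<open>auto simp: less_imp_neq[symmetric]\<close>)

text \<open>Smooth flows conserve entropy: the identity combines \<open>mass\<close> with
  \<open>pressure\<close> divided by p. The entropy inequality of the weak solution therefore holds
  with equality.\<close>

lemma entropy_flux_profile_deriv:
  "((\<lambda>y. entropy_flux \<gamma> (profile y)) has_real_derivative \<Lambda> y * entropy' y) (at y)"
proof -
  have pos: "r y > 0" "p y > 0" using r(3) p(3) by auto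
  have eq: "(\<lambda>y. entropy_flux \<gamma> (profile y)) = (\<lambda>y. entropy \<gamma> (profile y) * v y)"
    using r(3) by (simp add: entropy_flux_def profile_def less_imp_neq[symmetric])
  define q where "q = p' y / p y"
  have q: "p' y = q * p y" using pos by (simp add: q_def)
  have "p y * ((v y - \<Lambda> y) * q + \<gamma> * v' y) = 0"
    using pressure[of y] q by (simp add: algebra_simps)
  then have qe: "(v y - \<Lambda> y) * q + \<gamma> * v' y = 0" using pos by simp
  have "entropy' y * v y + entropy \<gamma> (profile y) * v' y = \<Lambda> y * entropy' y"
  proof -
    define l where "l = \<gamma> * ln (r y) - ln (p y) + ln (\<gamma> - 1)"
    have e: "entropy' y = r' y * (l + \<gamma>) - r y * q" "entropy \<gamma> (profile y) = r y * l"
      using pos by (simp_all add: entropy'_def l_def q_def entropy_profile algebra_simps)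
    have "entropy' y * v y + entropy \<gamma> (profile y) * v' y - \<Lambda> y * entropy' y
      = (l + \<gamma>) * ((v y - \<Lambda> y) * r' y + r y * v' y) - r y * ((v y - \<Lambda> y) * q + \<gamma> * v' y)"
      unfolding e by (simp add: algebra_simps)
    then show ?thesis using mass[of y] qe by simp
  qed
  moreover have "((\<lambda>y. entropy \<gamma> (profile y) * v y) has_real_derivative
      entropy' y * v y + entropy \<gamma> (profile y) * v' y) (at y)"
    by (rule DERIV_mult[OF entropy_profile_deriv v(1), THEN DERIV_cong]) simp
  ultimately show ?thesis unfolding eq by simp
qed

lemma rel_entropy_profile_deriv:
  assumes "w \<in> phys_states"
  shows "((\<lambda>y. rel_entropy \<gamma> (profile y) w) has_vector_derivative
           entropy' y - entropy_diff \<gamma> w (profile' y)) (at y)"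
  unfolding rel_entropy_eq[OF assms]
  using entropy_profile_deriv[of y, unfolded has_real_derivative_iff_has_vector_derivative]
    bounded_linear.has_vector_derivative[OF bounded_linear_entropy_diff[OF assms] profile_deriv]
  by (auto intro!: derivative_eq_intros)

lemma rel_flux_profile_deriv:
  assumes "w \<in> phys_states"
  shows "((\<lambda>y. rel_flux \<gamma> w (profile y)) has_vector_derivative
           \<Lambda> y *\<^sub>R (entropy' y - entropy_diff \<gamma> w (profile' y))) (at y)"
  unfolding rel_flux_def
  using entropy_flux_profile_deriv[of y, unfolded has_real_derivative_iff_has_vector_derivative]
    bounded_linear.has_vector_derivative[OF bounded_linear_entropy_diff[OF assms, of \<gamma>]
      flux_profile_deriv]
    linear_scale[OF bounded_linear.linear[OF bounded_linear_entropy_diff[OF assms, of \<gamma>]]]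
  by (auto intro!: derivative_eq_intros simp: right_diff_distrib)

text \<open>Both ends are placed where the flow is constant in time, one in a far field and one in
  the plateau, so the boundary fluxes integrate to a multiple of \<open>t - s\<close>.\<close>

lemma rel_entropy_balance:
  assumes w: "w \<in> phys_states" and "0 \<le> s" "s \<le> t" "t < \<tau>" "\<alpha> \<le> \<beta>"
    and "\<And>q. q \<in> {s..t} \<Longrightarrow> flow q \<alpha> = u1" "\<And>q. q \<in> {s..t} \<Longrightarrow> flow q \<beta> = u2"
  shows "integral {\<alpha>..\<beta>} (\<lambda>x. rel_entropy \<gamma> (flow t x) w)
       - integral {\<alpha>..\<beta>} (\<lambda>x. rel_entropy \<gamma> (flow s x) w)
       = - (t - s) * (rel_flux \<gamma> w u2 - rel_flux \<gamma> w u1)"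
proof -
  have "continuous_on UNIV (\<lambda>y. entropy' y - entropy_diff \<gamma> w (profile' y))"
    by (intro continuous_intros continuous_entropy' continuous_profile'
        bounded_linear.continuous_on[OF bounded_linear_entropy_diff[OF w]])
  from transported_balance[OF rel_entropy_profile_deriv[OF w] this rel_flux_profile_deriv[OF w] refl assms(2-5)]
  have "integral {\<alpha>..\<beta>} (\<lambda>x. rel_entropy \<gamma> (flow t x) w)
       - integral {\<alpha>..\<beta>} (\<lambda>x. rel_entropy \<gamma> (flow s x) w)
       = - integral {s..t} (\<lambda>q. rel_flux \<gamma> w (flow q \<beta>) - rel_flux \<gamma> w (flow q \<alpha>))"
    by (simp add: flow_def)
  also have "integral {s..t} (\<lambda>q. rel_flux \<gamma> w (flow q \<beta>) - rel_flux \<gamma> w (flow q \<alpha>))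
     = integral {s..t} (\<lambda>q. rel_flux \<gamma> w u2 - rel_flux \<gamma> w u1)"
    by (rule integral_cong) (simp add: assms)
  finally show ?thesis using assms(3) by (simp add: algebra_simps)
qed

lemma flow_0: "flow 0 = profile"
  by (simp add: flow_def fun_eq_iff)

lemma flow_phys: "flow t x \<in> phys_states"
  by (simp add: flow_def profile_phys)

lemma entropy_weak_solution_flow:
  assumes T: "0 < T" "T < \<tau>" and U: "range profile \<subseteq> U"
  shows "entropy_weak_solution \<gamma> T U flow profile"
  unfolding entropy_weak_solution_def
proof (intro conjI allI impI)
  show "(\<lambda>p. flow (fst p) (snd p)) \<in> borel_measurable lborel"
    unfolding flow_def using continuous_compose_foot[OF continuous_profile, of UNIV]
    by (simp add: borel_measurable_continuous_onI)
  show "\<forall>t\<in>{0<..<T}. \<forall>x. flow t x \<in> U" "\<And>x. profile x \<in> U"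
    using U by (auto simp: flow_def)
  show "profile \<in> borel_measurable lborel"
    using continuous_profile by (simp add: borel_measurable_continuous_onI)
  show "BV_loc T flow"
    by (rule transported_BV_loc[OF profile_deriv continuous_profile' T]) (simp add: flow_def)
next
  fix \<phi> \<phi>t \<phi>x
  assume "test_fn \<phi> \<phi>t \<phi>x \<and> (\<exists>T' R. T' < T \<and> (\<forall>t x. \<phi> t x \<noteq> 0 \<longrightarrow> t \<le> T' \<and> \<bar>x\<bar> \<le> R))"
  then obtain T' R where *: "test_fn \<phi> \<phi>t \<phi>x" "T' < T"
    "\<And>t x. \<phi> t x \<noteq> 0 \<Longrightarrow> t \<le> T' \<and> \<bar>x\<bar> \<le> R" by blast
  show "(LINT p : {0<..<T} \<times> UNIV | lborel.
            \<phi>t (fst p) (snd p) *\<^sub>R flow (fst p) (snd p)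
            + \<phi>x (fst p) (snd p) *\<^sub>R flux \<gamma> (flow (fst p) (snd p)))
        + (LINT x | lborel. \<phi> 0 x *\<^sub>R profile x) = 0"
    unfolding flow_def
    by (rule transported_weak_form[OF profile_deriv continuous_profile' flux_profile_deriv refl T *])
next
  fix \<phi> \<phi>t \<phi>x
  assume "test_fn \<phi> \<phi>t \<phi>x \<and> (\<forall>t x. 0 \<le> \<phi> t x) \<and> (\<exists>T1 T2 R. 0 < T1 \<and> T2 < T \<and>
           (\<forall>t x. \<phi> t x \<noteq> 0 \<longrightarrow> T1 \<le> t \<and> t \<le> T2 \<and> \<bar>x\<bar> \<le> R))"
  then obtain T1 T2 R where *: "test_fn \<phi> \<phi>t \<phi>x" "0 < T1" "T2 < T"
    "\<And>t x. \<phi> t x \<noteq> 0 \<Longrightarrow> T1 \<le> t \<and> t \<le> T2 \<and> \<bar>x\<bar> \<le> R" by blast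
  then have **: "\<phi> t x \<noteq> 0 \<Longrightarrow> t \<le> T2 \<and> \<bar>x\<bar> \<le> R" for t x by blast
  have z: "\<phi> 0 x = 0" for x using *(2) *(4)[of 0 x] by force
  have "(LINT p : {0<..<T} \<times> UNIV | lborel.
            \<phi>t (fst p) (snd p) *\<^sub>R entropy \<gamma> (profile (foot (fst p) (snd p)))
            + \<phi>x (fst p) (snd p) *\<^sub>R entropy_flux \<gamma> (profile (foot (fst p) (snd p))))
        + (LINT x | lborel. \<phi> 0 x *\<^sub>R entropy \<gamma> (profile x)) = 0"
    by (rule transported_weak_form[OF
        entropy_profile_deriv[unfolded has_real_derivative_iff_has_vector_derivative]
        continuous_entropy'
        entropy_flux_profile_deriv[unfolded has_real_derivative_iff_has_vector_derivative]
        _ T *(1,3) **]) simp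
  then show "0 \<le> (LINT p : {0<..<T} \<times> UNIV | lborel.
            \<phi>t (fst p) (snd p) * entropy \<gamma> (flow (fst p) (snd p))
            + \<phi>x (fst p) (snd p) * entropy_flux \<gamma> (flow (fst p) (snd p)))"
    by (simp add: flow_def z)
qed

end

section \<open>Growth of the weighted relative entropy around a balanced plateau\<close>

locale contact_perturbation = euler_profile +
  fixes a \<sigma> M c :: real and ul ur us :: state
  assumes contact: "contact2 \<gamma> ul ur \<sigma>"
    and a_pos: "0 < a"
    and M: "1 \<le> M"
    and left: "\<And>y. y \<le> - M \<Longrightarrow> profile y = ul"
    and right: "\<And>y. M \<le> y \<Longrightarrow> profile y = ur"
    and plateau: "\<And>y. \<bar>y\<bar> \<le> 1 \<Longrightarrow> profile y = us" "\<And>y. \<bar>y\<bar> \<le> 1 \<Longrightarrow> \<Lambda> y = c"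
    and balance: "rel_entropy \<gamma> us ul = a * rel_entropy \<gamma> us ur"
    and gain: "(vel us - \<sigma>) * (pres \<gamma> us - pres \<gamma> ul) * (1 / inte ul - a / inte ur) < 0"
begin

lemma phys: "ul \<in> phys_states" "ur \<in> phys_states" "us \<in> phys_states"
  using contact plateau(1)[of 0] profile_phys[of 0] by (auto simp: contact2_def)

lemma range_profile: "range profile = profile ` {-M..M}"
proof
  show "range profile \<subseteq> profile ` {-M..M}"
  proof (rule image_subsetI)
    fix y
    consider "y < -M" | "y > M" | "y \<in> {-M..M}" by force
    then show "profile y \<in> profile ` {-M..M}"
    proof cases
      case 1
      then have "profile y = profile (-M)" using left by simp
      then show ?thesis using M by auto
    next
      case 2
      then have "profile y = profile M" using right by simp
      then show ?thesis using M by auto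
    qed auto
  qed
qed auto

lemma compact_range_profile: "compact (range profile)"
  unfolding range_profile
  by (intro compact_continuous_image continuous_on_subset[OF continuous_profile]) auto

definition R where "R = M + \<tau> * B"

lemma R_ge: "1 \<le> R"
  using M mult_nonneg_nonneg[OF less_imp_le[OF tau_pos] B_nonneg] unfolding R_def by linarith

lemma flow_left: "x \<le> - R \<Longrightarrow> flow t x = ul"
  unfolding flow_def R_def using foot_near[of t x] by (intro left) linarith

lemma flow_right: "R \<le> x \<Longrightarrow> flow t x = ur"
  unfolding flow_def R_def using foot_near[of t x] by (intro right) linarith

text \<open>The plateau has half-width 1 initially; half of it is kept in reserve for the drift by
  \<open>t * c\<close>.\<close>

lemma flow_plateau:
  assumes "\<bar>x\<bar> \<le> 1/2" "\<bar>t\<bar> \<le> \<tau>" "\<bar>t * c\<bar> \<le> 1/2"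
  shows "flow t x = us"
proof -
  have y: "\<bar>x - t * c\<bar> \<le> 1" using assms by linarith
  have "foot t x = x - t * c"
    by (rule foot_unique) (use assms plateau(2)[OF y] in \<open>simp add: clip_eq\<close>)
  then show ?thesis using plateau(1)[OF y] by (simp add: flow_def)
qed

lemma continuous_rel_entropy_flow:
  "w \<in> phys_states \<Longrightarrow> continuous_on S (\<lambda>x. rel_entropy \<gamma> (flow t x) w)"
  unfolding flow_def using rel_entropy_profile_deriv
  by (intro continuous_compose_foot_x[where G = "\<lambda>y. rel_entropy \<gamma> (profile y) w"])
     (meson continuous_at_imp_continuous_on has_vector_derivative_continuous)

lemma rel_entropy_flow_nonneg: "w \<in> phys_states \<Longrightarrow> 0 \<le> rel_entropy \<gamma> (flow t x) w"
  by (rule rel_entropy_nonneg[OF gamma _ flow_phys])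

text \<open>The right side does not mention \<open>h\<close>: moving the shift within the plateau
  trades the relative entropy to \<open>ul\<close> for \<open>a\<close> times that to
  \<open>ur\<close>, and \<open>balance\<close> makes the two equal. The last summand is the
  contribution of the plateau interval, which has length 1.\<close>

lemma E_a_flow:
  assumes t: "\<bar>t\<bar> \<le> \<tau>" "\<bar>t * c\<bar> \<le> 1/2" and h: "\<bar>h\<bar> \<le> 1/2"
  shows "E_a \<gamma> a ul ur (flow t) h = ennreal
    (integral {-R..-1/2} (\<lambda>x. rel_entropy \<gamma> (flow t x) ul)
     + a * integral {1/2..R} (\<lambda>x. rel_entropy \<gamma> (flow t x) ur) + rel_entropy \<gamma> us ul)"
proof -
  let ?l = "\<lambda>x. rel_entropy \<gamma> (flow t x) ul" and ?r = "\<lambda>x. rel_entropy \<gamma> (flow t x) ur"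
  let ?I = "integral {-R..-1/2} ?l" and ?J = "integral {1/2..R} ?r"
  have hl: "(?l has_integral ?I) {-R..-1/2}" and hr: "(?r has_integral ?J) {1/2..R}"
    by (intro integrable_integral integrable_continuous_interval continuous_rel_entropy_flow phys)+
  have h': "-1/2 \<le> h" "h \<le> 1/2" using h by linarith+
  have pl: "flow t x = us" if "-1/2 \<le> x" "x \<le> 1/2" for x
    by (rule flow_plateau) (use that t in auto)
  have ch: "measure lborel {-1/2..h} = h + 1/2" "measure lborel {h..1/2} = 1/2 - h"
    using content_real[OF h'(1)] content_real[OF h'(2)] by simp_all
  have "((\<lambda>x. rel_entropy \<gamma> us ul) has_integral (h + 1/2) * rel_entropy \<gamma> us ul) {-1/2..h}"
    using has_integral_const_real[of "rel_entropy \<gamma> us ul" "-1/2" h] unfolding ch(1) by simp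
  then have "(?l has_integral (h + 1/2) * rel_entropy \<gamma> us ul) {-1/2..h}"
    by (rule has_integral_eq[rotated]) (use pl h' in auto)
  from has_integral_combine[OF _ _ hl this]
  have l: "(?l has_integral ?I + (h + 1/2) * rel_entropy \<gamma> us ul) {-R..h}"
    using R_ge h by (simp add: abs_le_iff)
  have "((\<lambda>x. rel_entropy \<gamma> us ur) has_integral (1/2 - h) * rel_entropy \<gamma> us ur) {h..1/2}"
    using has_integral_const_real[of "rel_entropy \<gamma> us ur" h "1/2"] unfolding ch(2) by simp
  then have "(?r has_integral (1/2 - h) * rel_entropy \<gamma> us ur) {h..1/2}"
    by (rule has_integral_eq[rotated]) (use pl h' in auto)
  from has_integral_combine[OF _ _ this hr]
  have r: "(?r has_integral (1/2 - h) * rel_entropy \<gamma> us ur + ?J) {h..R}"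
    using R_ge h by (simp add: abs_le_iff)
  \<comment> \<open>Interval and ray differ by the endpoint and by a tail on which the state is
    \<open>ul\<close>, whose relative entropy to itself is 0.\<close>
  have l': "(?l has_integral ?I + (h + 1/2) * rel_entropy \<gamma> us ul) {..<h}"
  proof (rule has_integral_spike_set_eq[THEN iffD1, OF _ _ l])
    show "negligible {x \<in> {-R..h} - {..<h}. ?l x \<noteq> 0}"
      by (rule negligible_subset[of "{h}"]) auto
    have "?l x = 0" if "x < - R" for x
      using flow_left[of x t] that phys by (simp add: rel_entropy_self)
    then have "{x \<in> {..<h} - {-R..h}. ?l x \<noteq> 0} = {}"
      by (auto simp: not_le)
    then show "negligible {x \<in> {..<h} - {-R..h}. ?l x \<noteq> 0}" by (simp only: negligible_empty)
  qed
  have r': "(?r has_integral (1/2 - h) * rel_entropy \<gamma> us ur + ?J) {h<..}"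
  proof (rule has_integral_spike_set_eq[THEN iffD1, OF _ _ r])
    show "negligible {x \<in> {h..R} - {h<..}. ?r x \<noteq> 0}"
      by (rule negligible_subset[of "{h}"]) auto
    have "?r x = 0" if "R < x" for x
      using flow_right[of x t] that phys by (simp add: rel_entropy_self)
    then have "{x \<in> {h<..} - {h..R}. ?r x \<noteq> 0} = {}"
      by (auto simp: not_le)
    then show "negligible {x \<in> {h<..} - {h..R}. ?r x \<noteq> 0}" by (simp only: negligible_empty)
  qed
  have nn: "0 \<le> ?l x" "0 \<le> ?r x" for x
    by (rule rel_entropy_flow_nonneg[OF phys(1)], rule rel_entropy_flow_nonneg[OF phys(2)])
  have pos: "0 \<le> ?I + (h + 1/2) * rel_entropy \<gamma> us ul" "0 \<le> (1/2 - h) * rel_entropy \<gamma> us ur + ?J"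
    using has_integral_nonneg[OF l'] has_integral_nonneg[OF r'] nn by auto
  have "E_a \<gamma> a ul ur (flow t) h = ennreal (?I + (h + 1/2) * rel_entropy \<gamma> us ul)
     + ennreal a * ennreal ((1/2 - h) * rel_entropy \<gamma> us ur + ?J)"
    unfolding E_a_def
    using nn_integral_has_integral_lebesgue'[OF _ l'] nn_integral_has_integral_lebesgue'[OF _ r'] nn
    by simp
  also have "\<dots> = ennreal (?I + (h + 1/2) * rel_entropy \<gamma> us ul
     + a * ((1/2 - h) * rel_entropy \<gamma> us ur + ?J))"
    using a_pos pos by (simp add: ennreal_mult[symmetric] ennreal_plus[symmetric] del: ennreal_plus)
  also have "?I + (h + 1/2) * rel_entropy \<gamma> us ul + a * ((1/2 - h) * rel_entropy \<gamma> us ur + ?J)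
     = ?I + a * ?J + rel_entropy \<gamma> us ul"
    unfolding balance by (simp add: algebra_simps)
  finally show ?thesis .
qed

lemma E_a_flow_increasing:
  assumes st: "0 \<le> s" "s < t" "t < \<tau>" "t * \<bar>c\<bar> \<le> 1/2" and h: "\<bar>h1\<bar> \<le> 1/2" "\<bar>h2\<bar> \<le> 1/2"
  shows "E_a \<gamma> a ul ur (flow s) h1 < E_a \<gamma> a ul ur (flow t) h2"
proof -
  have small: "\<bar>q\<bar> \<le> \<tau>" "\<bar>q * c\<bar> \<le> 1/2" if "q \<in> {s..t}" for q
  proof -
    show "\<bar>q\<bar> \<le> \<tau>" using that st by auto
    have "q * \<bar>c\<bar> \<le> t * \<bar>c\<bar>" using that by (intro mult_right_mono) auto
    then show "\<bar>q * c\<bar> \<le> 1/2" using that st by (simp add: abs_mult)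
  qed
  let ?I = "\<lambda>t. integral {-R..-1/2} (\<lambda>x. rel_entropy \<gamma> (flow t x) ul)"
  let ?J = "\<lambda>t. integral {1/2..R} (\<lambda>x. rel_entropy \<gamma> (flow t x) ur)"
  have I: "?I t - ?I s = - (t - s) * (rel_flux \<gamma> ul us - rel_flux \<gamma> ul ul)"
    using st R_ge small by (intro rel_entropy_balance phys flow_left flow_plateau) auto
  have J: "?J t - ?J s = - (t - s) * (rel_flux \<gamma> ur ur - rel_flux \<gamma> ur us)"
    using st R_ge small by (intro rel_entropy_balance phys flow_right flow_plateau) auto
  have v: "vel ul = \<sigma>" "vel ur = \<sigma>" "pres \<gamma> ur = pres \<gamma> ul"
    using contact by (auto simp: contact2_def)
  define W where "W = (vel us - \<sigma>) * (pres \<gamma> us - pres \<gamma> ul)"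
  have fl: "rel_flux \<gamma> ul us - rel_flux \<gamma> ul ul =
      vel us * rel_entropy \<gamma> us ul + W / inte ul"
    unfolding W_def using rel_flux_diff[of \<gamma> ul us] phys gamma v by simp
  have fr: "rel_flux \<gamma> ur us - rel_flux \<gamma> ur ur =
      vel us * rel_entropy \<gamma> us ur + W / inte ur"
    unfolding W_def using rel_flux_diff[of \<gamma> ur us] phys gamma v by simp
  have "(?I t + a * ?J t) - (?I s + a * ?J s) = (?I t - ?I s) + a * (?J t - ?J s)"
    by (simp add: algebra_simps)
  also have "\<dots> = (t - s) * (a * (rel_flux \<gamma> ur us - rel_flux \<gamma> ur ur)
      - (rel_flux \<gamma> ul us - rel_flux \<gamma> ul ul))"
    unfolding I J by (simp add: algebra_simps)
  \<comment> \<open>\<open>balance\<close> cancels the transport terms carrying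
    \<open>vel us\<close>; what remains is the pressure work \<open>W\<close>, whose sign is given
    by \<open>gain\<close>.\<close>
  also have "a * (rel_flux \<gamma> ur us - rel_flux \<gamma> ur ur) - (rel_flux \<gamma> ul us - rel_flux \<gamma> ul ul)
      = - (W * (1 / inte ul - a / inte ur))"
    unfolding fl fr balance by (simp add: algebra_simps)
  also have "(t - s) * - (W * (1 / inte ul - a / inte ur)) > 0"
    using gain st unfolding W_def by (intro mult_pos_pos) auto
  finally have less: "?I s + a * ?J s < ?I t + a * ?J t" by simp
  \<comment> \<open>\<open>ennreal\<close> sends negative numbers to 0, so the strict inequality
    survives only if the larger value is positive.\<close>
  have "0 \<le> ?I s" "0 \<le> ?J s"
    by (intro integral_nonneg integrable_continuous_interval continuous_rel_entropy_flow
        rel_entropy_flow_nonneg phys)+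
  then have "0 \<le> ?I s + a * ?J s + rel_entropy \<gamma> us ul"
    using a_pos rel_entropy_nonneg[OF gamma phys(1) phys(3)]
    by (intro add_nonneg_nonneg mult_nonneg_nonneg) simp_all
  then show ?thesis
    using E_a_flow[OF small h(1), of s] E_a_flow[OF small h(2), of t] st less
    by (simp add: ennreal_lessI)
qed

text \<open>With an infinite distance the bound on the shift would be vacuous for positive
  times.\<close>

lemma L2_perturbation_finite:
  "(\<integral>\<^sup>+ x. ennreal ((norm (profile x - shock_profile ul ur x))\<^sup>2) \<partial>lborel) < \<infinity>"
proof -
  obtain K where K: "\<And>y. norm (profile y) \<le> K"
    using compact_imp_bounded[OF compact_range_profile] unfolding bounded_iff by auto
  have b: "(norm (profile x - shock_profile ul ur x))\<^sup>2 \<le> (2 * K)\<^sup>2" for x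
  proof (rule power_mono)
    have "norm (shock_profile ul ur x) \<le> K"
      using K[of "-M"] K[of M] left[of "-M"] right[of M] by (simp add: shock_profile_def)
    then show "norm (profile x - shock_profile ul ur x) \<le> 2 * K"
      using K[of x] norm_triangle_ineq4[of "profile x" "shock_profile ul ur x"] by linarith
  qed simp
  have "(\<integral>\<^sup>+ x. ennreal ((norm (profile x - shock_profile ul ur x))\<^sup>2) \<partial>lborel)
    \<le> (\<integral>\<^sup>+ x. ennreal ((2 * K)\<^sup>2) * indicator {-M..M} x \<partial>lborel)"
  proof (rule nn_integral_mono)
    fix x
    show "ennreal ((norm (profile x - shock_profile ul ur x))\<^sup>2)
        \<le> ennreal ((2 * K)\<^sup>2) * indicator {-M..M} x"
    proof (cases "x \<in> {-M..M}")
      case True then show ?thesis using b by (simp add: ennreal_leI)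
    next
      case False
      then have "profile x = shock_profile ul ur x"
        using left[of x] right[of x] M by (auto simp: shock_profile_def)
      then show ?thesis by simp
    qed
  qed
  also have "\<dots> = ennreal ((2 * K)\<^sup>2) * emeasure lborel {-M..M}"
    by (simp add: nn_integral_cmult_indicator)
  also have "\<dots> < \<infinity>"
    using M by (simp add: ennreal_mult_less_top)
  finally show ?thesis .
qed

lemma not_a_contraction: "\<not> a_contraction \<gamma> a ul ur \<sigma>"
proof
  assume contr: "a_contraction \<gamma> a ul ur \<sigma>"
  let ?U = "convex hull (range profile)"
  have U: "?U \<subseteq> phys_states" "bounded ?U" "convex ?U"
    by (rule hull_minimal, rule image_subsetI, rule profile_phys, rule convex_phys_states,
        rule bounded_convex_hull[OF compact_imp_bounded[OF compact_range_profile]],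
        rule convex_convex_hull)
  obtain C where contr': "\<forall>T>0. \<forall>u u0.
          entropy_weak_solution \<gamma> T ?U u u0 \<and> E_a \<gamma> a ul ur u0 0 < \<infinity> \<longrightarrow>
          (\<exists>h. h 0 = 0 \<and> (\<exists>L. L-lipschitz_on {0..<T} h) \<and>
             (AE t in lborel. 0 < t \<and> t < T \<longrightarrow>
                (\<forall>D. (h has_real_derivative D) (at t) \<longrightarrow> \<bar>D\<bar> \<le> C)) \<and>
             (\<forall>t \<in> {0..<T}. ennreal ((h t - \<sigma> * t)\<^sup>2)
                 \<le> ennreal (C\<^sup>2 * t) *
                   (\<integral>\<^sup>+ x. ennreal ((norm (u0 x - shock_profile ul ur x))\<^sup>2) \<partial>lborel)) \<and>
             (AE p in lborel. 0 < fst p \<and> fst p < snd p \<and> snd p < T \<longrightarrow>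
                E_a \<gamma> a ul ur (u (snd p)) (h (snd p))
                  \<le> E_a \<gamma> a ul ur (u (fst p)) (h (fst p))))"
    using contr[unfolded a_contraction_def, THEN spec, THEN mp, OF conjI[OF U(1) conjI[OF U(2,3)]]]
    by (elim exE conjE)
  define N where
    "N = enn2real (\<integral>\<^sup>+ x. ennreal ((norm (profile x - shock_profile ul ur x))\<^sup>2) \<partial>lborel)"
  have N: "0 \<le> N"
    "(\<integral>\<^sup>+ x. ennreal ((norm (profile x - shock_profile ul ur x))\<^sup>2) \<partial>lborel) = ennreal N"
    using L2_perturbation_finite unfolding N_def infinity_ennreal_def
    by simp_all
  \<comment> \<open>The four terms give, in order: \<open>T < \<tau>\<close>; a drift of the plateau
    by at most 1/2; \<open>\<bar>\<sigma> * t\<bar> \<le> 1/4\<close>; and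
    \<open>\<bar>h t - \<sigma> * t\<bar> \<le> 1/4\<close>. The last two confine the shift to the
    half-width 1/2.\<close>
  define T where "T = Min {\<tau> / 2, 1 / (2 * (\<bar>c\<bar> + 1)), 1 / (4 * (\<bar>\<sigma>\<bar> + 1)), 1 / (16 * (C\<^sup>2 * N + 1))}"
  have CN: "0 \<le> C\<^sup>2 * N" using N by simp
  have T: "0 < T" unfolding T_def using tau_pos CN by (auto simp: add_nonneg_pos)
  have "T \<le> \<tau> / 2" unfolding T_def by (rule Min_le) auto
  then have T\<tau>: "T < \<tau>" using tau_pos by linarith
  have "T \<le> 1 / (2 * (\<bar>c\<bar> + 1))" unfolding T_def by (rule Min_le) auto
  then have "T * (2 * (\<bar>c\<bar> + 1)) \<le> 1" by (simp add: pos_le_divide_eq)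
  then have Tc: "T * \<bar>c\<bar> \<le> 1/2" using T by (simp add: algebra_simps)
  have "T \<le> 1 / (4 * (\<bar>\<sigma>\<bar> + 1))" unfolding T_def by (rule Min_le) auto
  then have "T * (4 * (\<bar>\<sigma>\<bar> + 1)) \<le> 1" by (simp add: pos_le_divide_eq)
  then have T\<sigma>: "\<bar>\<sigma>\<bar> * T \<le> 1/4" using T by (simp add: algebra_simps)
  have "T \<le> 1 / (16 * (C\<^sup>2 * N + 1))" unfolding T_def by (rule Min_le) auto
  then have "T * (16 * (C\<^sup>2 * N + 1)) \<le> 1" using CN by (simp add: pos_le_divide_eq)
  then have TN: "C\<^sup>2 * T * N \<le> 1/16" using T by (simp add: algebra_simps)
  have "E_a \<gamma> a ul ur profile 0 < \<infinity>"
    using E_a_flow[of 0 0] tau_pos by (simp add: flow_0)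
  with entropy_weak_solution_flow[OF T T\<tau> hull_subset]
  have "entropy_weak_solution \<gamma> T ?U flow profile \<and> E_a \<gamma> a ul ur profile 0 < \<infinity>" by (rule conjI)
  from contr'[THEN spec, THEN mp, OF T, THEN spec, THEN spec, THEN mp, OF this]
  obtain h where h: "\<And>t. t \<in> {0..<T} \<Longrightarrow> ennreal ((h t - \<sigma> * t)\<^sup>2) \<le> ennreal (C\<^sup>2 * t) * ennreal N"
    and ae: "AE p in lborel. 0 < fst p \<and> fst p < snd p \<and> snd p < T \<longrightarrow>
                E_a \<gamma> a ul ur (flow (snd p)) (h (snd p)) \<le> E_a \<gamma> a ul ur (flow (fst p)) (h (fst p))"
    unfolding N(2) by (elim exE conjE) (rule that, erule bspec)
  have hb: "\<bar>h t\<bar> \<le> 1/2" if t: "t \<in> {0..<T}" for t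
  proof -
    have "(h t - \<sigma> * t)\<^sup>2 \<le> C\<^sup>2 * t * N"
      using h[OF t] N t by (simp add: ennreal_mult[symmetric])
    also have "\<dots> \<le> C\<^sup>2 * T * N"
      using t N by (intro mult_right_mono mult_left_mono) auto
    also have "\<dots> \<le> (1/4)\<^sup>2" using TN by (simp add: power2_eq_square)
    finally have "\<bar>h t - \<sigma> * t\<bar> \<le> 1/4"
      unfolding abs_le_square_iff[symmetric] by simp
    moreover have "\<bar>\<sigma> * t\<bar> \<le> 1/4"
    proof -
      have "\<bar>\<sigma>\<bar> * t \<le> \<bar>\<sigma>\<bar> * T" using t by (intro mult_left_mono) auto
      then show ?thesis using T\<sigma> t by (simp add: abs_mult)
    qed
    ultimately show ?thesis by linarith
  qed
  \<comment> \<open>Monotonicity holds only for almost every pair of times, so a single violating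
    pair is not enough: every pair in this open rectangle, which lies in the region s < t, violates
    it.\<close>
  have "AE p in lborel. p \<notin> box (0, T/2) (T/2, T)"
    using ae
  proof (eventually_elim, intro notI)
    fix p :: "real \<times> real"
    assume le: "0 < fst p \<and> fst p < snd p \<and> snd p < T \<longrightarrow>
        E_a \<gamma> a ul ur (flow (snd p)) (h (snd p)) \<le> E_a \<gamma> a ul ur (flow (fst p)) (h (fst p))"
      and "p \<in> box (0, T/2) (T/2, T)"
    from this(2) have p: "0 < fst p" "fst p < snd p" "snd p < T"
      by (cases p; simp add: box_def Basis_prod_def)+
    have "snd p * \<bar>c\<bar> \<le> T * \<bar>c\<bar>" using p by (intro mult_right_mono) auto
    then have "E_a \<gamma> a ul ur (flow (fst p)) (h (fst p)) < E_a \<gamma> a ul ur (flow (snd p)) (h (snd p))"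
      using p T\<tau> Tc by (intro E_a_flow_increasing hb) auto
    then show False using le p by (simp add: not_less[symmetric])
  qed
  then have "box (0, T/2) (T/2, T) \<in> null_sets lborel"
    by (subst AE_iff_null_sets) auto
  then have "emeasure lborel (box (0, T/2) (T/2, T)) = 0" by auto
  moreover have "emeasure lborel (box (0, T/2) (T/2, T)) \<noteq> 0"
    using T by (subst emeasure_lborel_box) (auto simp: Basis_prod_def)
  ultimately show False by simp
qed

end

section \<open>A smooth step function\<close>

text \<open>Built from two copies of the C1 function z -> (max 0 z)^2: equal to 0 for z \<le> 0 and
  to 1 for z \<ge> 1. C1 regularity is what the transport along characteristics asks of the
  profile.\<close>

definition smooth_step :: "real \<Rightarrow> real" where
  "smooth_step z = 1 - (max 0 (1 - (max 0 z)\<^sup>2))\<^sup>2"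

definition smooth_step' :: "real \<Rightarrow> real" where
  "smooth_step' z = 4 * max 0 z * max 0 (1 - (max 0 z)\<^sup>2)"

lemma DERIV_max_square: "((\<lambda>z::real. (max 0 z)\<^sup>2) has_real_derivative 2 * max 0 z) (at z)"
proof -
  consider "z < 0" | "z = 0" | "z > 0" by linarith
  then show ?thesis
  proof cases
    case 1
    have "((\<lambda>z::real. 0) has_real_derivative 2 * max 0 z) (at z)" using 1 by simp
    then show ?thesis
      by (rule has_field_derivative_transform_within_open[of _ _ _ "{..<0}"]) (use 1 in auto)
  next
    case 2
    \<comment> \<open>At the gluing point \<open>max 0\<close> itself serves as Caratheodory's slope
      function.\<close>
    have "\<forall>w. (max 0 w)\<^sup>2 - (max 0 (0::real))\<^sup>2 = max 0 w * (w - 0)"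
      by (auto simp: max_def power2_eq_square)
    moreover have "isCont (\<lambda>w::real. max 0 w) 0"
      by (intro continuous_intros)
    ultimately show ?thesis unfolding 2 CARAT_DERIV by fastforce
  next
    case 3
    have "((\<lambda>z::real. z\<^sup>2) has_real_derivative 2 * max 0 z) (at z)"
      using 3 by (auto intro!: derivative_eq_intros)
    then show ?thesis
      by (rule has_field_derivative_transform_within_open[of _ _ _ "{0<..}"]) (use 3 in auto)
  qed
qed

lemma smooth_step_deriv: "(smooth_step has_real_derivative smooth_step' z) (at z)"
proof -
  have "((\<lambda>z. 1 - (max 0 z)\<^sup>2) has_real_derivative - (2 * max 0 z)) (at z)"
    using DERIV_diff[OF DERIV_const DERIV_max_square[of z]] by simp
  from DERIV_chain2[OF DERIV_max_square this]
  have "((\<lambda>z. 1 - (max 0 (1 - (max 0 z)\<^sup>2))\<^sup>2) has_real_derivative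
      0 - 2 * max 0 (1 - (max 0 z)\<^sup>2) * - (2 * max 0 z)) (at z)"
    by (intro DERIV_diff DERIV_const)
  then show ?thesis by (simp add: smooth_step_def[abs_def] smooth_step'_def mult_ac)
qed

lemma smooth_step_compose_deriv:
  "(f has_real_derivative f') (at y) \<Longrightarrow>
   ((\<lambda>y. smooth_step (f y)) has_real_derivative smooth_step' (f y) * f') (at y)"
  by (rule DERIV_chain2[OF smooth_step_deriv])

lemma continuous_smooth_step:
  "continuous_on S f \<Longrightarrow> continuous_on S (\<lambda>y. smooth_step (f y))"
  "continuous_on S f \<Longrightarrow> continuous_on S (\<lambda>y. smooth_step' (f y))"
  unfolding smooth_step_def smooth_step'_def by (intro continuous_intros; assumption)+

lemma smooth_step_le_0 [simp]: "z \<le> 0 \<Longrightarrow> smooth_step z = 0" "z \<le> 0 \<Longrightarrow> smooth_step' z = 0"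
  by (simp_all add: smooth_step_def smooth_step'_def)

lemma smooth_step_ge_1 [simp]: "1 \<le> z \<Longrightarrow> smooth_step z = 1" "1 \<le> z \<Longrightarrow> smooth_step' z = 0"
proof -
  assume "1 \<le> z"
  then have "max 0 (1 - (max 0 z)\<^sup>2) = 0" using one_le_power[of z 2] by simp
  then show "smooth_step z = 1" "smooth_step' z = 0"
    by (simp_all add: smooth_step_def smooth_step'_def)
qed

lemma smooth_step_bounds: "0 \<le> smooth_step z" "smooth_step z \<le> 1"
proof -
  have "(max 0 (1 - (max 0 z)\<^sup>2))\<^sup>2 \<le> 1\<^sup>2" by (intro power_mono) auto
  then show "0 \<le> smooth_step z" by (simp add: smooth_step_def)
  show "smooth_step z \<le> 1" by (simp add: smooth_step_def)
qed

lemma bounded_of_eventually_constant: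
  fixes f :: "real \<Rightarrow> real"
  assumes "continuous_on UNIV f" "\<And>y. K \<le> \<bar>y\<bar> \<Longrightarrow> f y = d"
  shows "\<exists>C. \<forall>y. \<bar>f y\<bar> \<le> C"
proof -
  have "bounded (f ` {-K..K})"
    by (intro compact_imp_bounded compact_continuous_image continuous_on_subset[OF assms(1)]) auto
  then obtain C where "\<forall>z\<in>f ` {-K..K}. norm z \<le> C"
    unfolding bounded_iff by blast
  then have "\<bar>f y\<bar> \<le> C" if "\<bar>y\<bar> < K" for y
    using that by (auto simp: abs_less_iff)
  then have "\<bar>f y\<bar> \<le> max C \<bar>d\<bar>" for y
    using assms(2)[of y] by (cases "K \<le> \<bar>y\<bar>") (auto simp: le_max_iff_disj)
  then show ?thesis by blast
qed

section \<open>Acoustic simple waves\<close>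

text \<open>States on the rarefaction curve of the acoustic family v + s c (s = 1 or -1) through the
  state with density \<open>\<rho>b\<close>, velocity \<open>\<sigma>\<close> and pressure P; the sound speed is the base
  sound speed times \<open>exp \<theta>\<close>.\<close>

definition simple_wave :: "real \<Rightarrow> real \<Rightarrow> real \<Rightarrow> real \<Rightarrow> real \<Rightarrow> real \<Rightarrow> state" where
  "simple_wave \<gamma> \<sigma> \<rho>b P s \<theta> =
     prim \<gamma> (\<rho>b * exp (2 / (\<gamma> - 1) * \<theta>))
       (\<sigma> + s * (2 / (\<gamma> - 1)) * sqrt (\<gamma> * P / \<rho>b) * (exp \<theta> - 1))
       (P * exp ((2 / (\<gamma> - 1) + 2) * \<theta>))"

lemma simple_wave_0: "simple_wave \<gamma> \<sigma> \<rho>b P s 0 = prim \<gamma> \<rho>b \<sigma> P"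
  by (simp add: simple_wave_def)

lemma inte_simple_wave:
  assumes "\<gamma> > 1" "\<rho>b > 0"
  shows "inte (simple_wave \<gamma> \<sigma> \<rho>b P s \<theta>) = P / ((\<gamma> - 1) * \<rho>b) * exp (2 * \<theta>)"
proof -
  have "exp ((2 / (\<gamma> - 1) + 2) * \<theta>) = exp (2 / (\<gamma> - 1) * \<theta>) * exp (2 * \<theta>)"
    by (simp add: exp_add[symmetric] algebra_simps)
  then show ?thesis using assms by (simp add: simple_wave_def inte_prim field_simps)
qed

lemma simple_wave_phys:
  "\<gamma> > 1 \<Longrightarrow> \<rho>b > 0 \<Longrightarrow> P > 0 \<Longrightarrow> simple_wave \<gamma> \<sigma> \<rho>b P s \<theta> \<in> phys_states"
  unfolding simple_wave_def by (intro prim_in_phys_states) auto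

text \<open>The specific entropy is constant along the wave, so the logarithms cancel.\<close>

lemma rel_entropy_simple_wave:
  assumes "\<gamma> > 1" "\<rho>b > 0" "P > 0" and w: "w \<in> phys_states" "vel w = \<sigma>"
  defines "eb \<equiv> P / ((\<gamma> - 1) * \<rho>b)"
  shows "rel_entropy \<gamma> (simple_wave \<gamma> \<sigma> \<rho>b P s \<theta>) w =
    \<rho>b * exp (2 / (\<gamma> - 1) * \<theta>) * (((\<gamma> - 1) * ln (\<rho>b / rho w) - ln (eb / inte w) - \<gamma>)
      + (eb * exp (2 * \<theta>) + (s * (2 / (\<gamma> - 1)) * sqrt (\<gamma> * P / \<rho>b) * (exp \<theta> - 1))\<^sup>2 / 2) / inte w)
    + (\<gamma> - 1) * rho w"
proof -
  define \<alpha> where "\<alpha> = 2 / (\<gamma> - 1)"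
  have \<alpha>: "(\<gamma> - 1) * \<alpha> = 2" unfolding \<alpha>_def
    by (rule nonzero_mult_div_cancel_left[of "\<gamma> - 1" 2, folded times_divide_eq_right])
       (use assms(1) in simp)
  define V where "V = s * \<alpha> * sqrt (\<gamma> * P / \<rho>b) * (exp \<theta> - 1)"
  define G where "G = \<rho>b * exp (\<alpha> * \<theta>)"
  have pos: "rho w > 0" "inte w > 0" "eb > 0" "G > 0"
    using w assms by (auto simp: phys_states_def eb_def G_def)
  let ?u = "simple_wave \<gamma> \<sigma> \<rho>b P s \<theta>"
  have u: "rho ?u = G" "vel ?u = \<sigma> + V" "inte ?u = eb * exp (2 * \<theta>)"
    using inte_simple_wave[OF assms(1,2), of \<sigma> P s \<theta>] pos
    unfolding eb_def by (simp_all add: simple_wave_def G_def[symmetric, unfolded \<alpha>_def] V_def \<alpha>_def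
        del: times_divide_eq_left times_divide_eq_right)
  have l1: "ln (G / rho w) = ln (\<rho>b / rho w) + \<alpha> * \<theta>"
    using pos assms(2) by (simp add: G_def ln_div ln_mult)
  have l2: "ln (eb * exp (2 * \<theta>) / inte w) = ln (eb / inte w) + 2 * \<theta>"
    using pos by (simp add: ln_div ln_mult)
  have "rel_entropy \<gamma> ?u w = (\<gamma> - 1) * (G * (ln (\<rho>b / rho w) + \<alpha> * \<theta>) - G + rho w)
    + G * (eb * exp (2 * \<theta>) / inte w - 1 - (ln (eb / inte w) + 2 * \<theta>)) + G * V\<^sup>2 / (2 * inte w)"
    unfolding rel_entropy_formula[OF w(1) simple_wave_phys[OF assms(1-3)]] u w(2) l1 l2 by simp
  also have "\<dots> = G * (((\<gamma> - 1) * ln (\<rho>b / rho w) - ln (eb / inte w) - \<gamma>)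
      + (eb * exp (2 * \<theta>) + V\<^sup>2 / 2) / inte w) + (\<gamma> - 1) * rho w
      + G * \<theta> * ((\<gamma> - 1) * \<alpha> - 2)"
    by (simp add: algebra_simps add_divide_distrib)
  finally show ?thesis
    unfolding \<alpha> diff_self mult_zero_right add_0_right unfolding G_def V_def \<alpha>_def .
qed

text \<open>\<open>s\<close> has the sign opposite to that of
  \<open>1 / inte ul - a / inte ur\<close>. For large \<theta> the energy term \<open>Z\<close>
  dominates, so \<open>H\<close> takes the sign opposite to \<open>s\<close>, while at 0 it has the
  sign of \<open>s\<close>.\<close>

lemma balanced_simple_wave_exists:
  fixes a s :: real
  assumes \<gamma>: "\<gamma> > 1" and "\<rho>b > 0" "P > 0"
    and ul: "ul \<in> phys_states" "vel ul = \<sigma>" and ur: "ur \<in> phys_states" "vel ur = \<sigma>"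
    and s: "\<bar>s\<bar> = 1" "s * (1 / inte ul - a / inte ur) < 0"
  defines "H \<equiv> \<lambda>\<theta>. rel_entropy \<gamma> (simple_wave \<gamma> \<sigma> \<rho>b P s \<theta>) ul
                 - a * rel_entropy \<gamma> (simple_wave \<gamma> \<sigma> \<rho>b P s \<theta>) ur"
  assumes H0: "0 < s * H 0"
  shows "\<exists>\<theta>>0. H \<theta> = 0"
proof -
  define eb where "eb = P / ((\<gamma> - 1) * \<rho>b)"
  define V where "V = (\<lambda>\<theta>. s * (2 / (\<gamma> - 1)) * sqrt (\<gamma> * P / \<rho>b) * (exp \<theta> - 1))"
  define kl kr where "kl = (\<gamma> - 1) * ln (\<rho>b / rho ul) - ln (eb / inte ul) - \<gamma>"
    and "kr = (\<gamma> - 1) * ln (\<rho>b / rho ur) - ln (eb / inte ur) - \<gamma>"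
  define G where "G = (\<lambda>\<theta>. \<rho>b * exp (2 / (\<gamma> - 1) * \<theta>))"
  define \<kappa> where "\<kappa> = 1 / inte ul - a / inte ur"
  define d where "d = (\<gamma> - 1) * (rho ul - a * rho ur)"
  have eb: "eb > 0" using assms by (simp add: eb_def)
  define Z where "Z = (\<lambda>\<theta>. eb * exp (2 * \<theta>) + (V \<theta>)\<^sup>2 / 2)"
  have Rl: "rel_entropy \<gamma> (simple_wave \<gamma> \<sigma> \<rho>b P s \<theta>) ul = G \<theta> * (kl + Z \<theta> / inte ul) + (\<gamma> - 1) * rho ul" for \<theta>
    unfolding G_def kl_def Z_def V_def eb_def
    by (rule rel_entropy_simple_wave[OF \<gamma> assms(2,3) ul])
  have Rr: "rel_entropy \<gamma> (simple_wave \<gamma> \<sigma> \<rho>b P s \<theta>) ur = G \<theta> * (kr + Z \<theta> / inte ur) + (\<gamma> - 1) * rho ur" for \<theta>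
    unfolding G_def kr_def Z_def V_def eb_def
    by (rule rel_entropy_simple_wave[OF \<gamma> assms(2,3) ur])
  have H: "H \<theta> = G \<theta> * (kl - a * kr + \<kappa> * Z \<theta>) + d" for \<theta>
    unfolding H_def Rl Rr by (simp add: \<kappa>_def d_def algebra_simps)
  have cG: "isCont G x" for x
    unfolding G_def by (intro isCont_mult isCont_exp' continuous_const continuous_ident)
  have cZ: "isCont Z x" for x
    unfolding Z_def V_def
    by (intro isCont_add isCont_divide isCont_power isCont_diff isCont_mult isCont_exp'
        continuous_const continuous_ident) simp
  have cH: "isCont (\<lambda>\<theta>. - s * H \<theta>) x" for x
    unfolding H by (intro isCont_add isCont_mult continuous_const cG cZ)
  \<comment> \<open>\<open>D\<close> bounds the part of \<open>H\<close> not containing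
    \<open>Z\<close>, after division by \<open>G \<theta>1\<close>, which is at least
    \<open>\<rho>b\<close>. \<open>\<theta>1\<close> is chosen so that already
    \<open>\<bar>\<kappa>\<bar> * eb * \<theta>1\<close> exceeds \<open>D\<close>; the exponential
    in \<open>Z\<close> is larger still.\<close>
  define D where "D = \<bar>kl - a * kr\<bar> + \<bar>d\<bar> / \<rho>b"
  define \<theta>1 where "\<theta>1 = D / (\<bar>\<kappa>\<bar> * eb) + 1"
  have \<kappa>: "s * \<kappa> = - \<bar>\<kappa>\<bar>" "\<bar>\<kappa>\<bar> > 0"
    using s unfolding \<kappa>_def[symmetric] by (auto simp: abs_if split: if_splits)
  have D0: "0 \<le> D" using assms(2) by (simp add: D_def)
  have \<theta>1: "1 \<le> \<theta>1" using D0 \<kappa> eb by (simp add: \<theta>1_def)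
  have G1: "\<rho>b \<le> G \<theta>1" "0 < G \<theta>1"
    using assms(2) \<theta>1 \<gamma> by (auto simp: G_def)
  have "D < \<bar>\<kappa>\<bar> * eb * \<theta>1"
    using \<kappa> eb by (simp add: \<theta>1_def distrib_left)
  also have "\<dots> \<le> \<bar>\<kappa>\<bar> * eb * exp (2 * \<theta>1)"
  proof (rule mult_left_mono)
    show "\<theta>1 \<le> exp (2 * \<theta>1)"
      using exp_ge_add_one_self[of "2 * \<theta>1"] \<theta>1 by linarith
  qed (use eb in simp)
  also have "\<dots> \<le> \<bar>\<kappa>\<bar> * Z \<theta>1"
    by (simp add: Z_def distrib_left)
  finally have big: "D < \<bar>\<kappa>\<bar> * Z \<theta>1" .
  have "\<bar>d\<bar> \<le> G \<theta>1 * (\<bar>d\<bar> / \<rho>b)"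
    using mult_right_mono[OF G1(1), of "\<bar>d\<bar> / \<rho>b"] assms(2) by simp
  moreover have "\<bar>s * d\<bar> = \<bar>d\<bar>" "\<bar>s * (kl - a * kr)\<bar> = \<bar>kl - a * kr\<bar>"
    using s(1) by (simp_all add: abs_mult)
  moreover have "- s * H \<theta>1 = G \<theta>1 * (- (s * (kl - a * kr))
      + \<bar>\<kappa>\<bar> * Z \<theta>1) - s * d"
  proof -
    have "- s * H \<theta>1 = G \<theta>1 * (- (s * (kl - a * kr)) - (s * \<kappa>) * Z \<theta>1) - s * d"
      unfolding H by (simp add: algebra_simps)
    then show ?thesis unfolding \<kappa>(1) by simp
  qed
  moreover have "G \<theta>1 * (\<bar>d\<bar> / \<rho>b) < G \<theta>1 * (- (s * (kl - a * kr))
      + \<bar>\<kappa>\<bar> * Z \<theta>1)"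
    using big calculation(3) G1(2) unfolding D_def by (intro mult_strict_left_mono) linarith+
  ultimately have "0 \<le> - s * H \<theta>1"
    by linarith
  then obtain \<theta> where \<theta>: "0 \<le> \<theta>" "- s * H \<theta> = 0"
    using IVT[of "\<lambda>\<theta>. - s * H \<theta>" 0 0 \<theta>1] H0 \<theta>1 cH by auto
  have "H \<theta> = 0" using \<theta>(2) s(1) by auto
  moreover have "\<theta> \<noteq> 0" using H0 calculation by auto
  ultimately show ?thesis using \<theta>(1) by (metis less_eq_real_def)
qed

section \<open>The perturbed contact discontinuity\<close>

lemma perturbed_contact_not_contractive:
  assumes \<gamma>: "\<gamma> > 1" and contact: "contact2 \<gamma> ul ur \<sigma>" and a: "0 < a" and \<rho>b: "0 < \<rho>b"
    and s: "\<bar>s\<bar> = 1" "s * (1 / inte ul - a / inte ur) < 0" and \<theta>: "0 < \<theta>"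
  defines "us \<equiv> simple_wave \<gamma> \<sigma> \<rho>b (pres \<gamma> ul) s \<theta>"
  assumes balance: "rel_entropy \<gamma> us ul = a * rel_entropy \<gamma> us ur"
  shows "\<not> a_contraction \<gamma> a ul ur \<sigma>"
proof -
  define P where "P = pres \<gamma> ul"
  define rl rr where "rl = rho ul" and "rr = rho ur"
  have phys: "ul \<in> phys_states" "ur \<in> phys_states"
    and v: "vel ul = \<sigma>" "vel ur = \<sigma>" and pr: "pres \<gamma> ur = P"
    using contact by (auto simp: contact2_def P_def)
  have rpos: "rl > 0" "rr > 0" using phys by (auto simp: phys_states_def rl_def rr_def)
  have P: "P > 0" using phys \<gamma> by (simp add: P_def pres_def phys_states_def)
  have ul: "ul = prim \<gamma> rl \<sigma> P" and ur: "ur = prim \<gamma> rr \<sigma> P"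
    using state_eq_prim[of \<gamma> ul] state_eq_prim[of \<gamma> ur] \<gamma> rpos v pr
    by (auto simp: rl_def rr_def P_def)
  \<comment> \<open>\<open>\<gamma> * \<alpha> = \<alpha> + 2\<close> says that pressure is
    proportional to density to the power \<gamma> along the wave: the wave is isentropic.\<close>
  define \<alpha> where "\<alpha> = 2 / (\<gamma> - 1)"
  have \<alpha>: "\<gamma> * \<alpha> = \<alpha> + 2" "\<alpha> > 0"
    using \<gamma> by (auto simp: \<alpha>_def field_simps)
  define c where "c = sqrt (\<gamma> * P / \<rho>b)"
  have c: "c > 0" "\<rho>b * c\<^sup>2 = \<gamma> * P"
    using \<gamma> P \<rho>b by (simp_all add: c_def)
  \<comment> \<open>The layers are nested. The pulse \<open>th\<close> lives in
    \<open>\<bar>y\<bar> \<le> 2\<close> and equals \<open>\<theta>\<close> for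
    \<open>\<bar>y\<bar> \<le> 1\<close>; the speed is acoustic up to 2 and falls back to
    \<open>\<sigma>\<close> before 3; the density \<open>rb\<close> leaves \<open>\<rho>b\<close>
    only beyond 3 and reaches its end values at distance 4. Between 2 and 3 the state is
    constant.\<close>
  define th th' where "th = (\<lambda>y. \<theta> * (1 - smooth_step (y\<^sup>2 - 1)))"
    and "th' = (\<lambda>y. - (\<theta> * (smooth_step' (y\<^sup>2 - 1) * (2 * y))))"
  define cut cut' where "cut = (\<lambda>y. 1 - smooth_step (y\<^sup>2 - 4))"
    and "cut' = (\<lambda>y. - (smooth_step' (y\<^sup>2 - 4) * (2 * y)))"
  define rb rb' where
    "rb = (\<lambda>y. \<rho>b + (rl - \<rho>b) * smooth_step (- y - 3) + (rr - \<rho>b) * smooth_step (y - 3))"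
    and "rb' = (\<lambda>y. (rr - \<rho>b) * smooth_step' (y - 3) - (rl - \<rho>b) * smooth_step' (- y - 3))"
  define r r' where "r = (\<lambda>y. rb y * exp (\<alpha> * th y))"
    and "r' = (\<lambda>y. rb' y * exp (\<alpha> * th y) + rb y * (exp (\<alpha> * th y) * (\<alpha> * th' y)))"
  define v v' where "v = (\<lambda>y. \<sigma> + s * \<alpha> * c * (exp (th y) - 1))"
    and "v' = (\<lambda>y. s * \<alpha> * c * (exp (th y) * th' y))"
  define p p' where "p = (\<lambda>y. P * exp ((\<alpha> + 2) * th y))"
    and "p' = (\<lambda>y. P * (exp ((\<alpha> + 2) * th y) * ((\<alpha> + 2) * th' y)))"
  \<comment> \<open>\<open>w\<close> is the acoustic speed relative to \<open>\<sigma>\<close>,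
    namely \<open>v - \<sigma> + s * c * exp th\<close>. Outside the pulse it equals
    \<open>s * c\<close> rather than 0, so \<open>cut\<close> has to bring the speed down before the
    density transition begins.\<close>
  define w w' where "w = (\<lambda>y. s * c * ((\<alpha> + 1) * exp (th y) - \<alpha>))"
    and "w' = (\<lambda>y. s * c * ((\<alpha> + 1) * (exp (th y) * th' y)))"
  define \<Lambda> \<Lambda>' where "\<Lambda> = (\<lambda>y. \<sigma> + cut y * w y)"
    and "\<Lambda>' = (\<lambda>y. cut' y * w y + cut y * w' y)"
  have dth: "(th has_real_derivative th' y) (at y)" for y
    unfolding th_def th'_def
    by (auto intro!: derivative_eq_intros smooth_step_compose_deriv)
  have dcut: "(cut has_real_derivative cut' y) (at y)" for y
    unfolding cut_def cut'_def
    by (auto intro!: derivative_eq_intros smooth_step_compose_deriv)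
  have drb: "(rb has_real_derivative rb' y) (at y)" for y
    unfolding rb_def rb'_def
    by (auto intro!: derivative_eq_intros smooth_step_compose_deriv)
  have dr: "(r has_real_derivative r' y) (at y)" for y
    unfolding r_def r'_def by (auto intro!: derivative_eq_intros dth drb)
  have dv: "(v has_real_derivative v' y) (at y)" for y
    unfolding v_def v'_def by (auto intro!: derivative_eq_intros dth)
  have dp: "(p has_real_derivative p' y) (at y)" for y
    unfolding p_def p'_def by (auto intro!: derivative_eq_intros dth)
  have dw: "(w has_real_derivative w' y) (at y)" for y
    unfolding w_def w'_def by (auto intro!: derivative_eq_intros dth)
  have d\<Lambda>: "(\<Lambda> has_real_derivative \<Lambda>' y) (at y)" for y
    unfolding \<Lambda>_def \<Lambda>'_def by (auto intro!: derivative_eq_intros dcut dw)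
  have cont: "continuous_on UNIV th'" "continuous_on UNIV cut'" "continuous_on UNIV rb'"
    unfolding th'_def cut'_def rb'_def by (intro continuous_intros continuous_smooth_step)+
  have cont': "continuous_on UNIV th" "continuous_on UNIV cut" "continuous_on UNIV rb"
    unfolding th_def cut_def rb_def by (intro continuous_intros continuous_smooth_step)+
  have c\<Lambda>': "continuous_on UNIV \<Lambda>'"
    unfolding \<Lambda>'_def w_def w'_def by (intro continuous_intros cont cont')
  have c\<Lambda>: "continuous_on UNIV \<Lambda>"
    unfolding \<Lambda>_def w_def by (intro continuous_intros cont cont')
  have cr': "continuous_on UNIV r'" and cv': "continuous_on UNIV v'" and cp': "continuous_on UNIV p'"
    unfolding r'_def v'_def p'_def by (intro continuous_intros cont cont')+
  have sq: "k\<^sup>2 \<le> y\<^sup>2" if "k \<le> \<bar>y\<bar>" "0 \<le> k" for k y :: real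
    using power_mono[OF that, of 2] by simp
  have sq': "y\<^sup>2 \<le> k\<^sup>2" if "\<bar>y\<bar> \<le> k" for k y :: real
    using power_mono[OF that abs_ge_zero, of 2] by simp
  have outer: "th y = 0" "th' y = 0" if "2 \<le> \<bar>y\<bar>" for y
    using sq[OF that] by (simp_all add: th_def th'_def)
  have far: "cut y = 0" "cut' y = 0" if "3 \<le> \<bar>y\<bar>" for y
    using sq[OF that] by (simp_all add: cut_def cut'_def)
  have near: "cut y = 1" if "\<bar>y\<bar> \<le> 2" for y
    using sq'[OF that] by (simp add: cut_def)
  have inner: "rb y = \<rho>b" "rb' y = 0" if "\<bar>y\<bar> \<le> 3" for y
    using that by (simp_all add: rb_def rb'_def abs_le_iff)
  have rb_pos: "0 < rb y" for y
  proof -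
    have conv: "0 < \<rho>b + (q - \<rho>b) * z" if "0 < q" "0 \<le> z" "z \<le> 1" for q z
    proof -
      have "\<rho>b + (q - \<rho>b) * z = \<rho>b * (1 - z) + q * z" by (simp add: algebra_simps)
      moreover have "0 < \<rho>b * (1 - z) + q * z"
        using that \<rho>b by (cases "z = 0") (auto intro: add_nonneg_pos)
      ultimately show ?thesis by simp
    qed
    show ?thesis
    proof (cases "0 \<le> y")
      case True
      then show ?thesis using conv[OF rpos(2) smooth_step_bounds] by (simp add: rb_def)
    next
      case False
      then show ?thesis using conv[OF rpos(1) smooth_step_bounds] by (simp add: rb_def)
    qed
  qed
  have \<Lambda>_far: "\<Lambda> y = \<sigma>" "\<Lambda>' y = 0" if "3 \<le> \<bar>y\<bar>" for y
    using far[OF that] by (simp_all add: \<Lambda>_def \<Lambda>'_def)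
  obtain B where B: "\<And>y. \<bar>\<Lambda> y\<bar> \<le> B"
    using bounded_of_eventually_constant[OF c\<Lambda>, of 3 \<sigma>] \<Lambda>_far by blast
  obtain L where L: "\<And>y. \<bar>\<Lambda>' y\<bar> \<le> L"
    using bounded_of_eventually_constant[OF c\<Lambda>', of 3 0] \<Lambda>_far by blast
  have L0: "0 \<le> L" using L[of 0] by linarith
  define \<tau> where "\<tau> = 1 / (2 * (L + 1))"
  have \<tau>: "0 < \<tau>" "\<tau> * L \<le> 1/2"
    using L0 by (auto simp: \<tau>_def field_simps)
  \<comment> \<open>The local sound speed is \<open>c * exp (th y)\<close>, so on the pulse the
    transport speed is exactly the characteristic speed of family \<open>s\<close>.\<close>
  have rel: "v y - \<Lambda> y = - s * c * exp (th y)" if "\<bar>y\<bar> \<le> 2" for y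
    using near[OF that] by (simp add: v_def \<Lambda>_def w_def algebra_simps)
  have s2: "s * s = 1" using s(1) by (metis abs_mult_self_eq mult_1)
  have ex: "exp ((\<alpha> + 2) * th y) = exp (\<alpha> * th y) * exp (th y) * exp (th y)" for y
    by (simp add: exp_add[symmetric] algebra_simps)
  have eqs: "(v y - \<Lambda> y) * r' y + r y * v' y = 0 \<and> r y * (v y - \<Lambda> y) * v' y + p' y = 0 \<and>
      (v y - \<Lambda> y) * p' y + \<gamma> * p y * v' y = 0" for y
  proof (cases "\<bar>y\<bar> \<le> 2")
    case True
    then have i: "rb y = \<rho>b" "rb' y = 0" using inner[of y] by auto
    define e f where "e = exp (th y)" and "f = exp (\<alpha> * th y)"
    have vals: "r y = \<rho>b * f" "r' y = \<rho>b * f * \<alpha> * th' y" "v' y = s * \<alpha> * c * e * th' y"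
      "p y = P * (f * e * e)" "p' y = P * (f * e * e) * (\<alpha> + 2) * th' y"
      "v y - \<Lambda> y = - s * c * e"
      using rel[OF True] by (simp_all add: r_def r'_def v'_def p_def p'_def i ex e_def f_def)
    have 1: "(v y - \<Lambda> y) * r' y + r y * v' y = 0"
      unfolding vals by simp
    have "r y * (v y - \<Lambda> y) * v' y + p' y
        = f * e * e * th' y * (P * (\<alpha> + 2) - (s * s) * \<alpha> * (\<rho>b * c\<^sup>2))"
      unfolding vals by (simp add: algebra_simps power2_eq_square)
    also have "P * (\<alpha> + 2) - (s * s) * \<alpha> * (\<rho>b * c\<^sup>2) = P * (\<alpha> + 2 - \<gamma> * \<alpha>)"
      unfolding s2 c(2) by (simp add: algebra_simps)
    finally have 2: "r y * (v y - \<Lambda> y) * v' y + p' y = 0"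
      unfolding \<alpha>(1) by simp
    have "(v y - \<Lambda> y) * p' y + \<gamma> * p y * v' y
        = s * c * e * P * (f * e * e) * th' y * (\<gamma> * \<alpha> - (\<alpha> + 2))"
      unfolding vals by (simp add: algebra_simps)
    then have 3: "(v y - \<Lambda> y) * p' y + \<gamma> * p y * v' y = 0"
      unfolding \<alpha>(1) by simp
    show ?thesis using 1 2 3 by blast
  next
    case False
    then have o: "th y = 0" "th' y = 0" using outer[of y] by auto
    \<comment> \<open>Off the pulse only the density varies. Either it is still constant, whatever
      the interpolated speed, or the speed has already become \<open>\<sigma> = v\<close>.\<close>
    have "(v y - \<Lambda> y) * rb' y = 0"
    proof (cases "\<bar>y\<bar> \<le> 3")
      case True then show ?thesis using inner by simp
    next
      case False then show ?thesis using \<Lambda>_far(1)[of y] o by (simp add: v_def)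
    qed
    then show ?thesis by (simp add: r'_def v'_def p'_def o)
  qed
  interpret E: euler_profile \<Lambda> \<Lambda>' L B \<tau> \<gamma> r r' v v' p p'
    using d\<Lambda> c\<Lambda>' L B \<tau> \<gamma> dr cr' dv cv' dp cp' eqs rb_pos P
    by unfold_locales (auto simp: r_def p_def)
  have prof: "E.profile y = prim \<gamma> (r y) (v y) (p y)" for y
    by (rule E.profile_def)
  interpret contact_perturbation \<Lambda> \<Lambda>' L B \<tau> \<gamma> r r' v v' p p' a \<sigma> 4 "\<Lambda> 0" ul ur us
  proof
    show "contact2 \<gamma> ul ur \<sigma>" "0 < a" "rel_entropy \<gamma> us ul = a * rel_entropy \<gamma> us ur"
      by (rule contact a balance)+
    show "(1::real) \<le> 4" by simp
    show "E.profile y = ul" if "y \<le> - 4" for y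
      unfolding prof ul using that outer[of y] by (simp add: r_def v_def p_def rb_def)
    show "E.profile y = ur" if "4 \<le> y" for y
      unfolding prof ur using that outer[of y] by (simp add: r_def v_def p_def rb_def)
    have th1: "th y = \<theta>" if "\<bar>y\<bar> \<le> 1" for y
      using sq'[OF that] by (simp add: th_def)
    show "E.profile y = us" if "\<bar>y\<bar> \<le> 1" for y
      unfolding prof us_def simple_wave_def P_def[symmetric] \<alpha>_def[symmetric] c_def[symmetric]
      using th1[OF that] inner[of y] that by (simp add: r_def v_def p_def)
    show "\<Lambda> y = \<Lambda> 0" if "\<bar>y\<bar> \<le> 1" for y
      using th1[OF that] th1[of 0] near[of y] near[of 0] that by (simp add: \<Lambda>_def w_def)
    have "vel us - \<sigma> = s * \<alpha> * c * (exp \<theta> - 1)"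
      using \<rho>b by (simp add: us_def simple_wave_def \<alpha>_def c_def P_def)
    moreover have "pres \<gamma> us - pres \<gamma> ul = P * (exp ((\<alpha> + 2) * \<theta>) - 1)"
      using \<rho>b \<gamma> by (simp add: us_def simple_wave_def \<alpha>_def P_def algebra_simps)
    ultimately have "(vel us - \<sigma>) * (pres \<gamma> us - pres \<gamma> ul) * (1 / inte ul - a / inte ur)
       = \<alpha> * c * (exp \<theta> - 1) * (P * (exp ((\<alpha> + 2) * \<theta>) - 1)) * (s * (1 / inte ul - a / inte ur))"
      by simp
    also have "\<dots> < 0"
      by (rule mult_pos_neg[OF _ s(2)], intro mult_pos_pos) (use \<alpha>(2) c(1) \<theta> P in auto)
    finally show "(vel us - \<sigma>) * (pres \<gamma> us - pres \<gamma> ul) * (1 / inte ul - a / inte ur) < 0" .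
  qed
  show ?thesis by (rule not_a_contraction)
qed

text \<open>At parameter 0 the wave is \<open>ub\<close> itself, so the initial sign condition of
  the intermediate value argument can be read off at an end state of the contact.\<close>

lemma not_a_contraction_of_base_state:
  assumes \<gamma>: "\<gamma> > 1" and contact: "contact2 \<gamma> ul ur \<sigma>" and a: "0 < a"
    and s: "\<bar>s\<bar> = 1" "s * (1 / inte ul - a / inte ur) < 0"
    and ub: "ub = ul \<or> ub = ur"
    and pos: "0 < s * (rel_entropy \<gamma> ub ul - a * rel_entropy \<gamma> ub ur)"
  shows "\<not> a_contraction \<gamma> a ul ur \<sigma>"
proof -
  have phys: "ul \<in> phys_states" "ur \<in> phys_states" "ub \<in> phys_states"
    and v: "vel ul = \<sigma>" "vel ur = \<sigma>" "vel ub = \<sigma>" and p: "pres \<gamma> ub = pres \<gamma> ul"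
    using contact ub by (auto simp: contact2_def)
  have \<rho>: "rho ub > 0" and P: "pres \<gamma> ul > 0"
    using phys \<gamma> by (auto simp: phys_states_def pres_def)
  have ub0: "simple_wave \<gamma> \<sigma> (rho ub) (pres \<gamma> ul) s 0 = ub"
    using state_eq_prim[of \<gamma> ub] \<gamma> \<rho> v p by (simp add: simple_wave_0)
  obtain \<theta> where "\<theta> > 0" "rel_entropy \<gamma> (simple_wave \<gamma> \<sigma> (rho ub) (pres \<gamma> ul) s \<theta>) ul
      - a * rel_entropy \<gamma> (simple_wave \<gamma> \<sigma> (rho ub) (pres \<gamma> ul) s \<theta>) ur = 0"
    using balanced_simple_wave_exists[OF \<gamma> \<rho> P phys(1) v(1) phys(2) v(2) s] pos ub0 by auto
  then show ?thesis
    by (intro perturbed_contact_not_contractive[OF \<gamma> contact a \<rho> s]) auto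
qed

theorem theorem6p2:
  fixes \<gamma> \<sigma> :: real and ul ur :: state
  assumes "\<gamma> > 1"
    and "contact2 \<gamma> ul ur \<sigma>"
  shows "(inte ul > inte ur \<longrightarrow>
            (\<forall>a. (0 < a \<and> a < inte ur / inte ul) \<or> 1 < a \<longrightarrow> \<not> a_contraction \<gamma> a ul ur \<sigma>)) \<and>
         (inte ul < inte ur \<longrightarrow>
            (\<forall>a. (0 < a \<and> a < 1) \<or> inte ur / inte ul < a \<longrightarrow> \<not> a_contraction \<gamma> a ul ur \<sigma>))"
proof -
  have phys: "ul \<in> phys_states" "ur \<in> phys_states" and pr: "pres \<gamma> ul = pres \<gamma> ur"
    using assms(2) by (auto simp: contact2_def)
  have e: "inte ul > 0" "inte ur > 0" using phys by (auto simp: phys_states_def)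
  have neq: "rho ul \<noteq> rho ur" if "inte ul \<noteq> inte ur"
    using pr that e assms(1) phys by (auto simp: pres_def phys_states_def)
  \<comment> \<open>At \<open>ul\<close> the relative entropy to \<open>ul\<close> vanishes, so the
    difference to be annihilated starts negative. This matches \<open>s = -1\<close>, the family for
    which a below e_r/e_l gives growth.\<close>
  have small: "\<not> a_contraction \<gamma> a ul ur \<sigma>"
    if "inte ul \<noteq> inte ur" "0 < a" "a < inte ur / inte ul" for a
  proof (rule not_a_contraction_of_base_state[OF assms that(2), where s = "-1" and ub = ul])
    have "a / inte ur < 1 / inte ul" using that e by (simp add: field_simps)
    then show "- 1 * (1 / inte ul - a / inte ur) < 0" by simp
    show "0 < - 1 * (rel_entropy \<gamma> ul ul - a * rel_entropy \<gamma> ul ur)"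
      using rel_entropy_pos[OF assms(1) phys(2,1) neq[OF that(1)]] that(2) phys
      by (simp add: rel_entropy_self)
  qed auto
  \<comment> \<open>The mirror case: at \<open>ur\<close> the relative entropy to \<open>ur\<close>
    vanishes and the difference starts positive, matching \<open>s = 1\<close>.\<close>
  have large: "\<not> a_contraction \<gamma> a ul ur \<sigma>"
    if "inte ul \<noteq> inte ur" "inte ur / inte ul < a" for a
  proof (rule not_a_contraction_of_base_state[OF assms, where s = 1 and ub = ur])
    show "0 < a" using that e by (smt (verit) divide_pos_pos)
    have "1 / inte ul < a / inte ur" using that e by (simp add: field_simps)
    then show "1 * (1 / inte ul - a / inte ur) < 0" by simp
    show "0 < 1 * (rel_entropy \<gamma> ur ul - a * rel_entropy \<gamma> ur ur)"
      using rel_entropy_pos[OF assms(1) phys neq[OF that(1), symmetric]] phys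
      by (simp add: rel_entropy_self)
  qed auto
  \<comment> \<open>If e_l > e_r, then e_r/e_l < 1, so a > 1 falls under \<open>large\<close>; if
    e_l < e_r, then e_r/e_l > 1, so a < 1 falls under \<open>small\<close>.\<close>
  show ?thesis
  proof (intro conjI impI allI)
    fix a assume "inte ur < inte ul" "0 < a \<and> a < inte ur / inte ul \<or> 1 < a"
    moreover from this e have "inte ur / inte ul < 1" by simp
    ultimately show "\<not> a_contraction \<gamma> a ul ur \<sigma>" using small[of a] large[of a] by auto
  next
    fix a assume "inte ul < inte ur" "0 < a \<and> a < 1 \<or> inte ur / inte ul < a"
    moreover from this e have "1 < inte ur / inte ul" by simp
    ultimately show "\<not> a_contraction \<gamma> a ul ur \<sigma>" using small[of a] large[of a] by auto
  qed
qed

end
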